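(* Let $x_o\in\mathbb R^n$ and let the target be $\mathcal T=\{x_o\}$. Suppose that there are $m$ groups of available vector fields $f^{(i)}_1,\dots,f^{(i)}_{j(i)}$, $i=1,\dots,m$, and integers $k_i>0$ such that $f^{(i)}_r\in C^{k_i-1}(\mathbb R^n;\mathbb R^n)$, with $j(i)=1$ if $k_i=1$, such that for every $i=1,\dots,m$ $$(H_{f^{(i)}_1}\boxplus\dots\boxplus H_{f^{(i)}_{j(i)}})^r I(x_o)=0\quad\text{for } 1\le r<k_i,\qquad A^o_i:=\frac1{k_i!}(H_{f^{(i)}_1}\boxplus\dots\boxplus H_{f^{(i)}_{j(i)}})^{k_i}I(x_o)\ne0 ,$$ and let $\bar k=\max_i k_i$. Suppose moreover that the $m$ columns of the $n\times m$ matrix $A_o=(A^o_i)_{i=1,\dots,m}$ are a positive basis of $\mathbb R^n$. Then the target $\mathcal T=\{x_o\}$ is STLA and there is a constant $C$ such that the minimum time function satisfies $$T(x)\le C|x-x_o|^{1/\bar k}$$ for all $x$ in a neighborhood of $x_o$. In particular, if there is $L>0$ with $|F(x,a)-F(y,a)|\le L|x-y|$ for all $x,y\in\mathbb R^n$, $a\in A$, then $T$ is locally $1/\bar k$-H\"older continuous in its domain $\{x:T(x)<+\infty\}$.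
   Context: Control system: $\dot x_t=F(x_t,a_t)$, $x_0=x\in\mathbb R^n$, where $A$ is a compact subset of a metric space, $F:\mathbb R^n\times A\to\mathbb R^n$ is continuous, and there are $R,L>0$ with $|F(x,a)-F(y,a)|\le L|x-y|$ for all $x,y\in B_R(x_o)$, $a\in A$. Here $B_r(x_o)=\{x:|x-x_o|\le r\}$. It is a standing assumption that the system guarantees existence, uniqueness and uniform boundedness of trajectories. A vector field $f:\mathbb R^n\to\mathbb R^n$ is available if there is $a\in A$ with $f(x)=F(x,a)$ for all $x$. The minimum time function is $T(x)=\inf_{a_\cdot\in L^\infty((0,+\infty);A)}t_x(a)\in[0,+\infty]$, where $t_x(a)=\min\{t\ge0:x_t\in\mathcal T\}\ (\le+\infty)$ and $x_t$ is the trajectory with control $a_\cdot$ and initial point $x$. The target is STLA (small time locally attainable) at $x_o$ if $T$ is continuous at $x_o$ (note $T(x_o)=0$). For a vector field $f$ and a scalar function $u$, sufficiently smooth, put $H_f^{(0)}u=u$, $H_fu=f\cdot\nabla u$, $H_f^{(j+1)}u=H_f(H_f^{(j)}u)$. For vector fields $f_1,\dots,f_m$ and integer $r\ge0$, $$(H_{f_1}\boxplus\dots\boxplus H_{f_m})^r u=\sum_{i_1+\dots+i_m=r}\frac{r!}{i_1!\cdots i_m!}\,H_{f_1}^{(i_1)}\circ\dots\circ H_{f_m}^{(i_m)}u .$$ For vector valued functions these operators act componentwise. $I(x)=x$ is the identity function on $\mathbb R^n$. A family $a_1,\dots,a_m\in\mathbb R^k$ is a positive basis of $\mathbb R^k$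 if every $x\in\mathbb R^k$ can be written $x=\sum_{i=1}^m\lambda_ia_i$ with all $\lambda_i\ge0$. *)

theory Defs
  imports "HOL-Analysis.Analysis"
begin

type_synonym 'n vfield = "real ^ 'n \<Rightarrow> real ^ 'n"


section \<open>Control systems and the minimum time function\<close>

text \<open>
  Representatives of the elements of $L^\infty((0,+\infty);A)$.  Boundedness is automatic since
  \<open>A\<close> is compact wherever this is used.  The values of a control on \<open>{..0}\<close> are irrelevant.
\<close>

definition controls :: "'b::metric_space set \<Rightarrow> (real \<Rightarrow> 'b) set" where
  "controls A = {a \<in> borel_measurable (lebesgue_on {0<..}). \<forall>t>0. a t \<in> A}"

text \<open>
  Solutions on $[0,+\infty)$ in the sense of Caratheodory, i.e. locally absolutely continuous curves
  satisfying the differential equation almost everywhere.  The values of \<open>y\<close> at negative times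
  are unconstrained.
\<close>

definition is_trajectory ::
  "(real ^ 'n \<Rightarrow> 'b \<Rightarrow> real ^ 'n) \<Rightarrow> (real \<Rightarrow> 'b) \<Rightarrow> real ^ 'n \<Rightarrow> (real \<Rightarrow> real ^ 'n) \<Rightarrow> bool"
where
  "is_trajectory F a x y \<longleftrightarrow>
     continuous_on {0..} y \<and>
     (\<forall>t\<ge>0. (\<lambda>s. F (y s) (a s)) absolutely_integrable_on {0..t} \<and>
            y t = x + integral {0..t} (\<lambda>s. F (y s) (a s)))"

text \<open>
  Existence, uniqueness and uniform boundedness of trajectories.  Boundedness is on finite time
  horizons and uniform with respect to the control (a bound on all of $[0,+\infty)$ would already
  exclude the system with \<open>F x a = a\<close>).
\<close>

definition well_posed ::
  "(real ^ 'n \<Rightarrow> 'b::metric_space \<Rightarrow> real ^ 'n) \<Rightarrow> 'b set \<Rightarrow> bool"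
where
  "well_posed F A \<longleftrightarrow>
     (\<forall>x. \<forall>a\<in>controls A. \<exists>y. is_trajectory F a x y) \<and>
     (\<forall>x. \<forall>a\<in>controls A. \<forall>y z. is_trajectory F a x y \<longrightarrow> is_trajectory F a x z \<longrightarrow>
        (\<forall>t\<ge>0. y t = z t)) \<and>
     (\<forall>x. \<forall>\<tau>\<ge>0. \<exists>M. \<forall>a\<in>controls A. \<forall>y. is_trajectory F a x y \<longrightarrow>
        (\<forall>t\<in>{0..\<tau>}. norm (y t) \<le> M))"

text \<open>
  $t_x(a)$, with value \<open>\<infinity>\<close> if the target is never reached.  For a closed target the infimum of a
  nonempty set of hitting times is attained; under \<^const>\<open>well_posed\<close> the curve \<open>y\<close> is unique on
  $[0,+\infty)$.
\<close>

definition hitting_time ::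
  "(real ^ 'n \<Rightarrow> 'b \<Rightarrow> real ^ 'n) \<Rightarrow> (real ^ 'n) set \<Rightarrow> real ^ 'n \<Rightarrow> (real \<Rightarrow> 'b) \<Rightarrow> ennreal"
where
  "hitting_time F Target x a =
     Inf {ennreal t |t. t \<ge> 0 \<and> (\<exists>y. is_trajectory F a x y \<and> y t \<in> Target)}"

definition min_time ::
  "(real ^ 'n \<Rightarrow> 'b::metric_space \<Rightarrow> real ^ 'n) \<Rightarrow> 'b set \<Rightarrow> (real ^ 'n) set \<Rightarrow> real ^ 'n \<Rightarrow> ennreal"
where
  "min_time F A Target x = (INF a\<in>controls A. hitting_time F Target x a)"

definition STLA ::
  "(real ^ 'n \<Rightarrow> 'b::metric_space \<Rightarrow> real ^ 'n) \<Rightarrow> 'b set \<Rightarrow> (real ^ 'n) set \<Rightarrow> real ^ 'n \<Rightarrow> bool"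
where
  "STLA F A Target x\<^sub>o \<longleftrightarrow> isCont (min_time F A Target) x\<^sub>o"

definition available ::
  "(real ^ 'n \<Rightarrow> 'b \<Rightarrow> real ^ 'n) \<Rightarrow> 'b set \<Rightarrow> 'n vfield \<Rightarrow> bool"
where
  "available F A f \<longleftrightarrow> (\<exists>a\<in>A. \<forall>x. f x = F x a)"


section \<open>Differential operators along vector fields\<close>

text \<open>The class $C^k$ on the whole space.\<close>

primrec Ck :: "nat \<Rightarrow> ('a::euclidean_space \<Rightarrow> 'b::real_normed_vector) \<Rightarrow> bool" where
  "Ck 0 f \<longleftrightarrow> continuous_on UNIV f"
| "Ck (Suc k) f \<longleftrightarrow>
     (\<forall>x. f differentiable (at x)) \<and> (\<forall>v. Ck k (\<lambda>x. frechet_derivative f (at x) v))"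

definition grad :: "(real ^ 'n \<Rightarrow> real) \<Rightarrow> real ^ 'n \<Rightarrow> real ^ 'n" where
  "grad u x = (\<chi> i. frechet_derivative u (at x) (axis i 1))"

definition H :: "'n vfield \<Rightarrow> (real ^ 'n \<Rightarrow> real) \<Rightarrow> real ^ 'n \<Rightarrow> real" where
  "H f u x = f x \<bullet> grad u x"

text \<open>
  \<open>H_comp [f\<^sub>1, \<dots>, f\<^sub>m] [i\<^sub>1, \<dots>, i\<^sub>m]\<close> is the operator
  $H_{f_1}^{(i_1)} \circ \dots \circ H_{f_m}^{(i_m)}$; the last field acts first.
\<close>

definition H_comp ::
  "'n vfield list \<Rightarrow> nat list \<Rightarrow> (real ^ 'n \<Rightarrow> real) \<Rightarrow> real ^ 'n \<Rightarrow> real"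
where
  "H_comp fs is = foldr (\<circ>) (map2 (\<lambda>f i. H f ^^ i) fs is) id"

definition H_boxplus ::
  "'n vfield list \<Rightarrow> nat \<Rightarrow> (real ^ 'n \<Rightarrow> real) \<Rightarrow> real ^ 'n \<Rightarrow> real"
where
  "H_boxplus fs r u x =
     (\<Sum>is | length is = length fs \<and> sum_list is = r.
        fact r / (\<Prod>i\<leftarrow>is. fact i) * H_comp fs is u x)"

text \<open>The index set in the preceding sum is finite, so the sum is a genuine one.\<close>

lemma finite_multi_indices: "finite {is :: nat list. length is = l \<and> sum_list is = r}"
  by (rule finite_subset[OF _ finite_lists_length_eq[of "{..r}" l]])
    (auto intro: member_le_sum_list)

definition H_boxplus_vec ::
  "'n vfield list \<Rightarrow> nat \<Rightarrow> (real ^ 'n \<Rightarrow> real ^ 'k) \<Rightarrow> real ^ 'n \<Rightarrow> real ^ 'k"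
where
  "H_boxplus_vec fs r u x = (\<chi> l. H_boxplus fs r (\<lambda>z. u z $ l) x)"


section \<open>Positive bases and local Hoelder continuity\<close>

definition positive_basis :: "nat \<Rightarrow> (nat \<Rightarrow> 'a::real_vector) \<Rightarrow> bool" where
  "positive_basis m v \<longleftrightarrow>
     (\<forall>x. \<exists>c::nat \<Rightarrow> real. (\<forall>i\<in>{1..m}. c i \<ge> 0) \<and> x = (\<Sum>i=1..m. c i *\<^sub>R v i))"

definition locally_holder_on ::
  "real \<Rightarrow> 'a::metric_space set \<Rightarrow> ('a \<Rightarrow> 'b::metric_space) \<Rightarrow> bool"
where
  "locally_holder_on \<alpha> S f \<longleftrightarrow>
     (\<forall>z\<in>S. \<exists>\<delta>>0. \<exists>C. \<forall>x\<in>S \<inter> ball z \<delta>. \<forall>y\<in>S \<inter> ball z \<delta>.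
        dist (f x) (f y) \<le> C * dist x y powr \<alpha>)"

end

theory Submission
  imports Defs
begin

text \<open>
  Follow the fields of group \<open>i\<close> one after the other, each for a time \<open>t\<close>. Up to an error that is
  small compared with \<open>t ^ k i\<close>, a start in \<open>x\<^sub>o\<close> ends in \<open>x\<^sub>o + t ^ k i *\<^sub>R A\<^sub>o i\<close>
  (\<open>group_flow_leading_term\<close>): along the flow of a field \<open>g\<close> a function \<open>u\<close> develops like the
  exponential series of \<open>H g\<close>, composing flows multiplies the series, and the coefficients of the
  product are the operators \<open>H_boxplus\<close>, of which those of positive order below \<open>k i\<close> vanish at \<open>x\<^sub>o\<close>.

  A start in a nearby point \<open>x\<close> changes the displacement by at most \<open>K * t * norm (x - x\<^sub>o)\<close>, because
  the displacement is an integral over a time of order \<open>t\<close> of Lipschitz fields. Hence the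
  Taylor expansion is needed only for the start in \<open>x\<^sub>o\<close>, where the low order terms vanish. Both
  facts are joined in \<open>group_flow_step\<close>.

  Since the columns are a positive basis, \<open>x\<^sub>o - x\<close> is a combination of them with coefficients
  \<open>c i \<ge> 0\<close> of size at most a constant times the distance \<open>\<rho>\<close> of \<open>x\<close> from \<open>x\<^sub>o\<close>. Following the groups
  for the times \<open>root (k i) (c i)\<close>, which are at most of order \<open>root kbar \<rho>\<close>, would lead exactly to \<open>x\<^sub>o\<close>
  without the errors. The errors are small compared with \<open>\<rho>\<close>, so the distance is at least halved
  (\<open>contraction_step\<close>). Repeating this takes times that are dominated by a geometric series, hence
  the concatenation of all the controls arrives in \<open>x\<^sub>o\<close> in a finite time of order \<open>root kbar \<rho>\<close>
  (\<open>attainable_from_contraction\<close>, which rests on \<open>reaches_limit\<close>).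

  For the Hoelder estimate, a control that steers \<open>x\<close> to \<open>x\<^sub>o\<close> in time \<open>\<tau>\<close> steers a neighbour \<open>y\<close> to
  within \<open>exp (L * \<tau>) * norm (x - y)\<close> of \<open>x\<^sub>o\<close>, and the local estimate pays for the rest of the way
  (\<open>min_time_locally_holder\<close>).
\<close>

section \<open>Calculus of differentiable functions and Lie derivatives\<close>

lemma Ck_Suc_imp: "Ck (Suc k) f \<Longrightarrow> Ck k f"
proof (induction k arbitrary: f)
  case 0
  then show ?case
    by (auto intro!: continuous_at_imp_continuous_on differentiable_imp_continuous_within)
next
  case (Suc k)
  then show ?case by (metis Ck.simps(2))
qed

lemma Ck_mono: "Ck k f \<Longrightarrow> j \<le> k \<Longrightarrow> Ck j f"
  by (induction k) (auto simp: le_Suc_eq simp del: Ck.simps dest: Ck_Suc_imp)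

lemma Ck_const: "Ck k (\<lambda>x. c)"
  by (induction k arbitrary: c) auto

lemma Ck_SucI:
  assumes "\<And>x. (f has_derivative f' x) (at x)" "\<And>v. Ck k (\<lambda>x. f' x v)"
  shows "Ck (Suc k) f"
proof -
  have "frechet_derivative f (at x) = f' x" for x
    using assms(1) frechet_derivative_at by metis
  with assms show ?thesis by (auto simp: differentiable_def)
qed

lemma Ck_SucD:
  "Ck (Suc k) f \<Longrightarrow> (f has_derivative frechet_derivative f (at x)) (at x)"
  by (metis Ck.simps(2) frechet_derivative_works)

lemma Ck_add: "Ck k f \<Longrightarrow> Ck k g \<Longrightarrow> Ck k (\<lambda>x. f x + g x)"
proof (induction k arbitrary: f g)
  case 0
  then show ?case by (auto intro: continuous_intros)
next
  case (Suc k)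
  show ?case
  proof (rule Ck_SucI)
    show "((\<lambda>x. f x + g x) has_derivative
       (\<lambda>v. frechet_derivative f (at x) v + frechet_derivative g (at x) v)) (at x)" for x
      using Suc.prems by (intro has_derivative_add Ck_SucD)
    show "Ck k (\<lambda>x. frechet_derivative f (at x) v + frechet_derivative g (at x) v)" for v
      using Suc by auto
  qed
qed

lemma Ck_sum:
  assumes "\<And>j. j \<in> J \<Longrightarrow> Ck k (f j)"
  shows "Ck k (\<lambda>x. \<Sum>j\<in>J. f j x)"
  using assms by (induction J rule: infinite_finite_induct) (auto intro: Ck_const Ck_add)

lemma Ck_mult:
  fixes f g :: "'a::euclidean_space \<Rightarrow> real"
  shows "Ck k f \<Longrightarrow> Ck k g \<Longrightarrow> Ck k (\<lambda>x. f x * g x)"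
proof (induction k arbitrary: f g)
  case 0
  then show ?case by (auto intro: continuous_intros)
next
  case (Suc k)
  show ?case
  proof (rule Ck_SucI)
    show "((\<lambda>x. f x * g x) has_derivative
       (\<lambda>v. f x * frechet_derivative g (at x) v + frechet_derivative f (at x) v * g x)) (at x)" for x
      using Suc.prems by (intro has_derivative_mult Ck_SucD)
    show "Ck k (\<lambda>x. f x * frechet_derivative g (at x) v + frechet_derivative f (at x) v * g x)" for v
      using Suc.prems Ck_Suc_imp[OF Suc.prems(1)] Ck_Suc_imp[OF Suc.prems(2)]
      by (intro Ck_add Suc.IH) auto
  qed
qed

lemma Ck_linear:
  assumes "bounded_linear h" "Ck k f"
  shows "Ck k (\<lambda>x. h (f x))"
  using assms(2)
proof (induction k arbitrary: f)
  case 0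
  then show ?case using bounded_linear.continuous_on[OF assms(1)] by auto
next
  case (Suc k)
  show ?case
  proof (rule Ck_SucI)
    show "((\<lambda>x. h (f x)) has_derivative (\<lambda>v. h (frechet_derivative f (at x) v))) (at x)" for x
      using Suc.prems by (intro bounded_linear.has_derivative[OF assms(1)] Ck_SucD)
    show "Ck k (\<lambda>x. h (frechet_derivative f (at x) v))" for v
      using Suc by auto
  qed
qed

lemma Ck_nth: "Ck k f \<Longrightarrow> Ck k (\<lambda>x. f x $ i)"
  by (rule Ck_linear[OF bounded_linear_vec_nth])

lemma Ck_ident: "Ck k (\<lambda>x. x)"
proof (cases k)
  case (Suc j)
  show ?thesis unfolding Suc by (rule Ck_SucI[OF has_derivative_ident Ck_const])
qed simp

text \<open>
  Only for differentiable \<open>u\<close> is the derivative linear and thus determined by the gradient. This is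
  what ties \<^const>\<open>H\<close> to the chain rule along integral curves.
\<close>

lemma H_eq_derivative:
  assumes "u differentiable (at x)"
  shows "H g u x = frechet_derivative u (at x) (g x)"
proof -
  interpret linear "frechet_derivative u (at x)"
    using assms by (rule linear_frechet_derivative)
  have "frechet_derivative u (at x) (g x) =
      frechet_derivative u (at x) (\<Sum>i\<in>UNIV. g x $ i *\<^sub>R axis i 1)"
    using basis_expansion[of "g x"] by (simp add: scalar_mult_eq_scaleR)
  also have "\<dots> = H g u x"
    by (simp add: sum scale H_def grad_def inner_vec_def)
  finally show ?thesis ..
qed

text \<open>Each application of \<^const>\<open>H\<close> costs one derivative of \<open>u\<close>, but none of \<open>g\<close>.\<close>

lemma Ck_H:
  assumes "Ck (Suc p) u" "Ck p g"
  shows "Ck p (H g u)"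
  unfolding H_def[abs_def] grad_def inner_vec_def
  using assms by (auto intro!: Ck_sum Ck_mult Ck_nth)

lemma Ck_H_power:
  assumes "Ck (p + s) u" "Ck (p + s - 1) g"
  shows "Ck p ((H g ^^ s) u)"
  using assms
proof (induction s arbitrary: p)
  case (Suc s)
  have "Ck (Suc p) ((H g ^^ s) u)" using Suc.prems by (intro Suc.IH) (simp_all del: Ck.simps)
  moreover have "Ck p g" using Suc.prems(2) by (rule Ck_mono) simp
  ultimately show ?case by (simp add: Ck_H del: Ck.simps)
qed simp

lemma H_sum:
  assumes "finite J" "\<And>j. j \<in> J \<Longrightarrow> v j differentiable (at x)"
  shows "H g (\<lambda>y. \<Sum>j\<in>J. c j * v j y) x = (\<Sum>j\<in>J. c j * H g (v j) x)"
proof -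
  have "((\<lambda>y. \<Sum>j\<in>J. c j * v j y) has_derivative
      (\<lambda>w. \<Sum>j\<in>J. c j * frechet_derivative (v j) (at x) w)) (at x)"
    using assms by (intro has_derivative_sum has_derivative_mult_right)
      (auto simp: frechet_derivative_works)
  note d = this
  have "(\<lambda>y. \<Sum>j\<in>J. c j * v j y) differentiable (at x)"
    using d by (auto simp: differentiable_def)
  moreover note frechet_derivative_at[OF d, symmetric]
  ultimately show ?thesis using assms by (simp add: H_eq_derivative)
qed

lemma H_power_sum:
  assumes "finite J" "\<And>j. j \<in> J \<Longrightarrow> Ck s (v j)" "Ck (s - 1) g"
  shows "(H g ^^ s) (\<lambda>y. \<Sum>j\<in>J. c j * v j y) = (\<lambda>y. \<Sum>j\<in>J. c j * (H g ^^ s) (v j) y)"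
  using assms(2,3)
proof (induction s)
  case (Suc s)
  have "(H g ^^ s) (\<lambda>y. \<Sum>j\<in>J. c j * v j y) = (\<lambda>y. \<Sum>j\<in>J. c j * (H g ^^ s) (v j) y)"
  proof (intro Suc.IH)
    show "Ck s (v j)" if "j \<in> J" for j using Suc.prems(1)[OF that] by (rule Ck_Suc_imp)
    show "Ck (s - 1) g" using Suc.prems(2) by (rule Ck_mono) simp
  qed
  moreover have "(H g ^^ s) (v j) differentiable (at x)" if "j \<in> J" for j x
  proof -
    have "Ck (Suc 0) ((H g ^^ s) (v j))"
      using Suc.prems that by (intro Ck_H_power) (auto simp del: Ck.simps)
    then show ?thesis by simp
  qed
  ultimately show ?case using assms(1) by (auto simp: H_sum)
qed simp

lemma H_comp_Nil: "H_comp [] [] u = u"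
  by (simp add: H_comp_def)

lemma H_comp_Cons: "H_comp (g # gs) (i # is) u = (H g ^^ i) (H_comp gs is u)"
  by (simp add: H_comp_def)

lemma Ck_H_comp:
  assumes "\<And>g. g \<in> set gs \<Longrightarrow> Ck (k - 1) g" "Ck k u"
    and "length is = length gs" "p + sum_list is \<le> k"
  shows "Ck p (H_comp gs is u)"
  using assms
proof (induction gs arbitrary: "is" p)
  case Nil
  then show ?case by (auto simp: H_comp_Nil intro: Ck_mono)
next
  case (Cons g gs)
  then obtain i js where js: "is = i # js" by (cases "is") auto
  have "Ck (p + i) (H_comp gs js u)" using Cons.prems js by (intro Cons.IH) auto
  moreover have "Ck (p + i - 1) g"
    by (rule Ck_mono[of "k - 1"]) (use Cons.prems js in auto)
  ultimately show ?case unfolding js H_comp_Cons by (rule Ck_H_power)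
qed

lemma Ck_H_boxplus:
  assumes "\<And>g. g \<in> set gs \<Longrightarrow> Ck (k - 1) g" "Ck k u" "p + r \<le> k"
  shows "Ck p (H_boxplus gs r u)"
  unfolding H_boxplus_def[abs_def]
  using assms by (intro Ck_sum Ck_mult Ck_const Ck_H_comp[of gs k]) auto

text \<open>
  Splitting a multi-index by its first entry, parametrised by the weight \<open>r\<close> of the tail. This makes
  \<open>H_boxplus_Cons\<close> a Cauchy product.
\<close>

lemma multi_indices_Suc:
  "{is :: nat list. length is = Suc l \<and> sum_list is = q} =
     (\<lambda>(r, js). (q - r) # js) ` (SIGMA r:{..q}. {js. length js = l \<and> sum_list js = r})"
(is "?L = ?f ` ?R")
proof (intro equalityI subsetI)
  fix "is" assume "is \<in> ?L"
  then obtain i js where js: "is = i # js" "length js = l" "i + sum_list js = q"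
    by (auto simp: length_Suc_conv)
  then have "is = ?f (sum_list js, js)" "(sum_list js, js) \<in> ?R" by auto
  then show "is \<in> ?f ` ?R" by (rule image_eqI)
qed auto

text \<open>
  With formal exponentials, the coefficient identity behind
  \<open>exp (t H\<^sub>1) \<circ> \<dots> \<circ> exp (t H\<^sub>m) = exp (t H\<^sub>1) \<circ> (exp (t H\<^sub>2) \<circ> \<dots> \<circ> exp (t H\<^sub>m))\<close>: the coefficients
  of \<open>t ^ q\<close> on the two sides agree because the powers of \<open>H g\<close> are linear on the smooth functions to
  which they are applied.
\<close>

lemma H_boxplus_Cons:
  assumes "\<And>h. h \<in> set (g # gs) \<Longrightarrow> Ck (k - 1) h" "Ck k u" "q \<le> k"
  shows "H_boxplus (g # gs) q u x / fact q =
    (\<Sum>r\<le>q. (H g ^^ (q - r)) (H_boxplus gs r u) x / (fact (q - r) * fact r))"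
proof -
  let ?I = "\<lambda>r. {js :: nat list. length js = length gs \<and> sum_list js = r}"
  let ?c = "\<lambda>js. (\<Prod>i\<leftarrow>js. fact i) :: real"
  have "H_boxplus (g # gs) q u x =
      (\<Sum>(r, js)\<in>Sigma {..q} ?I. fact q / ?c ((q - r) # js) * H_comp (g # gs) ((q - r) # js) u x)"
    unfolding H_boxplus_def list.size Suc_eq_plus1[symmetric] add_0_right add_Suc_right multi_indices_Suc
    by (subst sum.reindex) (auto simp: inj_on_def split_def)
  also have "\<dots> = (\<Sum>r\<le>q. \<Sum>js\<in>?I r.
        fact q / ?c ((q - r) # js) * H_comp (g # gs) ((q - r) # js) u x)"
    by (subst sum.Sigma) (auto simp: finite_multi_indices)
  also have "\<dots> = (\<Sum>r\<le>q. fact q * ((H g ^^ (q - r)) (H_boxplus gs r u) x / (fact (q - r) * fact r)))"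
  proof (rule sum.cong)
    fix r assume r: "r \<in> {..q}"
    have "(H g ^^ (q - r)) (H_boxplus gs r u) x =
        (\<Sum>js\<in>?I r. fact r / ?c js * (H g ^^ (q - r)) (H_comp gs js u) x)"
      unfolding H_boxplus_def[abs_def]
    proof (subst H_power_sum)
      show "Ck (q - r) (H_comp gs js u)" if "js \<in> ?I r" for js
        using assms that r by (intro Ck_H_comp[of gs k]) auto
      show "Ck (q - r - 1) g"
        by (rule Ck_mono[of "k - 1"]) (use assms in auto)
    qed (auto simp: finite_multi_indices)
    then show "(\<Sum>js\<in>?I r. fact q / ?c ((q - r) # js) * H_comp (g # gs) ((q - r) # js) u x) =
       fact q * ((H g ^^ (q - r)) (H_boxplus gs r u) x / (fact (q - r) * fact r))"
      by (simp add: H_comp_Cons sum_distrib_left sum_divide_distrib field_simps)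
  qed simp
  finally show ?thesis by (simp only: sum_distrib_left[symmetric]) simp
qed

lemma H_boxplus_Nil: "H_boxplus [] r u x = (if r = 0 then u x else 0)"
proof -
  have "{is :: nat list. length is = length ([] :: 'a list) \<and> sum_list is = r} = (if r = 0 then {[]} else {})"
    by auto
  then show ?thesis by (auto simp: H_boxplus_def H_comp_Nil)
qed

lemma H_boxplus_0: "H_boxplus gs 0 u x = u x"
proof -
  have "{is :: nat list. length is = length gs \<and> sum_list is = 0} = {replicate (length gs) 0}"
    by (auto intro: replicate_eqI simp: sum_list_replicate)
  moreover have "H_comp gs (replicate (length gs) 0) u = u"
    by (induction gs) (simp_all add: H_comp_Nil H_comp_Cons)
  ultimately show ?thesis by (simp add: H_boxplus_def prod_list_replicate)
qed

lemma H_power_along_curve: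
  assumes u: "Ck p u" and g: "Ck (p - 1) g" and r: "r < p"
    and y: "(y has_vector_derivative g (y s)) (at s within S)"
  shows "((\<lambda>s. (H g ^^ r) u (y s)) has_vector_derivative (H g ^^ Suc r) u (y s)) (at s within S)"
proof -
  have "Ck (Suc 0) ((H g ^^ r) u)"
  proof (rule Ck_H_power)
    show "Ck (Suc 0 + r) u" using u by (rule Ck_mono) (use r in simp)
    show "Ck (Suc 0 + r - 1) g" using g by (rule Ck_mono) (use r in simp)
  qed
  then have d: "(H g ^^ r) u differentiable (at (y s))" by simp
  have "((H g ^^ r) u has_derivative frechet_derivative ((H g ^^ r) u) (at (y s))) (at (y s))"
    using d by (simp add: frechet_derivative_works)
  then have "((H g ^^ r) u has_derivative frechet_derivative ((H g ^^ r) u) (at (y s))) (at (y s) within y ` S)"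
    by (rule has_derivative_at_withinI)
  from vector_derivative_diff_chain_within[OF y this] show ?thesis
    using d by (simp add: o_def H_eq_derivative)
qed

text \<open>
  Taylor's formula for \<open>u \<circ> y\<close>, whose derivatives are \<open>(H g ^^ r) u \<circ> y\<close>. The curve is given for
  nonnegative times only, hence the one-sided derivatives and the integral form of the remainder. The
  remainder is bounded by the oscillation of the top derivative, so that this derivative need only be
  continuous.
\<close>

lemma Taylor_along_curve:
  assumes u: "Ck p u" and g: "Ck (p - 1) g" and t: "t \<ge> 0"
    and y: "\<And>s. s \<in> {0..t} \<Longrightarrow> (y has_vector_derivative g (y s)) (at s within {0..t})"
    and e: "\<And>s. s \<in> {0..t} \<Longrightarrow> \<bar>(H g ^^ p) u (y s) - (H g ^^ p) u (y 0)\<bar> \<le> e"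
  shows "\<bar>u (y t) - (\<Sum>r\<le>p. t ^ r / fact r * (H g ^^ r) u (y 0))\<bar> \<le> e * t ^ p"
proof (cases "p = 0")
  case True
  then show ?thesis using e[of t] t by simp
next
  case False
  define D where "D r s = (H g ^^ r) u (y s)" for r s
  have D: "(D r has_vector_derivative D (Suc r) s) (at s within {0..t})"
    if "r < p" "0 \<le> s" "s \<le> t" for r s
    unfolding D_def using that by (intro H_power_along_curve[OF u g] y) auto
  have e0: "e \<ge> 0" using e[of 0] t by simp
  have I: "((\<lambda>s. ((t - s) ^ (p - 1) / fact (p - 1)) *\<^sub>R D p s) has_integral
      D 0 t - (\<Sum>r<p. ((t - 0) ^ r / fact r) *\<^sub>R D r 0)) {0..t}"
    using False by (intro Taylor_has_integral D t) auto
  \<comment> \<open>The term of order \<open>p\<close> is the remainder integral with the top derivative frozen at time 0.\<close>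
  have J: "((\<lambda>s. ((t - s) ^ (p - 1) / fact (p - 1)) *\<^sub>R D p 0) has_integral
      t ^ p / fact p * D p 0) {0..t}"
  proof -
    obtain q where q: "p = Suc q" using False by (cases p) auto
    define c where "c = D p 0 / fact p"
    have c: "real (Suc q) * c = D p 0 / fact q" unfolding c_def q fact_Suc by (simp add: divide_simps del: of_nat_Suc)
    have "((\<lambda>s. - ((t - s) ^ Suc q * c)) has_real_derivative (real (Suc q) * c) * (t - s) ^ q)
        (at s within {0..t})" for s
      by (rule derivative_eq_intros refl | simp)+
    then have "((\<lambda>s. - ((t - s) ^ p / fact p * D p 0)) has_vector_derivative
        ((t - s) ^ (p - 1) / fact (p - 1)) *\<^sub>R D p 0) (at s within {0..t})" for s
      unfolding has_real_derivative_iff_has_vector_derivative[symmetric] c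
      by (simp add: q c_def mult.commute)
    from fundamental_theorem_of_calculus[OF t this] show ?thesis
      using False by (simp add: power_0_left)
  qed
  have "norm (D 0 t - (\<Sum>r<p. ((t - 0) ^ r / fact r) *\<^sub>R D r 0) - t ^ p / fact p * D p 0)
     \<le> (e * t ^ (p - 1)) * measure lborel {0..t}"
  proof (rule has_integral_bound_real[OF _ finite.emptyI has_integral_diff[OF I J]])
    show "0 \<le> e * t ^ (p - 1)" using e0 t by simp
    fix s assume "s \<in> {0..t} - {}"
    then have s: "s \<in> {0..t}" by simp
    have "norm ((t - s) ^ (p - 1) / fact (p - 1) * (D p s - D p 0)) \<le> t ^ (p - 1) * e"
      unfolding norm_mult
    proof (rule mult_mono)
      have "(t - s) ^ (p - 1) / fact (p - 1) \<le> (t - s) ^ (p - 1) / 1"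
        using s by (intro divide_left_mono) (auto simp: fact_ge_1)
      also have "\<dots> \<le> t ^ (p - 1)" using s by (auto intro: power_mono)
      finally show "norm ((t - s) ^ (p - 1) / fact (p - 1)) \<le> t ^ (p - 1)" using s by simp
    qed (use e[OF s] t in \<open>auto simp: D_def\<close>)
    then show "norm (((t - s) ^ (p - 1) / fact (p - 1)) *\<^sub>R D p s -
        ((t - s) ^ (p - 1) / fact (p - 1)) *\<^sub>R D p 0) \<le> e * t ^ (p - 1)"
      by (simp only: real_scaleR_def right_diff_distrib[symmetric] mult.commute[of e])
  qed
  moreover have "t ^ (p - 1) * t = t ^ p" using False by (cases p) auto
  moreover have "(\<Sum>r\<le>p. t ^ r / fact r * (H g ^^ r) u (y 0)) =
      (\<Sum>r<p. ((t - 0) ^ r / fact r) *\<^sub>R D r 0) + t ^ p / fact p * D p 0"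
    by (simp add: D_def lessThan_Suc_atMost[symmetric])
  ultimately show ?thesis using t by (simp add: D_def mult.assoc algebra_simps)
qed

section \<open>Controls and trajectories\<close>

text \<open>
  In terms of preimages of open sets, pasting and delaying controls amount to unions and translations
  of Lebesgue measurable sets of times.
\<close>

lemma controls_iff:
  "a \<in> controls A \<longleftrightarrow>
     (\<forall>t>0. a t \<in> A) \<and> (\<forall>B. open B \<longrightarrow> {t. 0 < t \<and> a t \<in> B} \<in> sets lebesgue)"
proof -
  have r: "X \<in> sets (lebesgue_on {0<..}) \<longleftrightarrow> X \<subseteq> {0<..} \<and> X \<in> sets lebesgue" for X :: "real set"
    by (rule sets_restrict_space_iff) auto
  have e: "a -` B \<inter> space (lebesgue_on {0<..}) = {t. 0 < t \<and> a t \<in> B}" for B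
    by auto
  have "a \<in> borel_measurable (lebesgue_on {0<..}) \<longleftrightarrow>
      (\<forall>B. open B \<longrightarrow> {t. 0 < t \<and> a t \<in> B} \<in> sets lebesgue)" (is "?L = ?R")
  proof
    assume ?L
    show ?R
    proof (intro allI impI)
      fix B :: "'a set" assume "open B"
      then have "a -` B \<inter> space (lebesgue_on {0<..}) \<in> sets (lebesgue_on {0<..})"
        by (intro measurable_sets[OF \<open>?L\<close>]) auto
      then show "{t. 0 < t \<and> a t \<in> B} \<in> sets lebesgue" unfolding e r by simp
    qed
  next
    assume ?R
    show ?L
    proof (rule borel_measurableI)
      fix B :: "'a set" assume "open B"
      with \<open>?R\<close> show "a -` B \<inter> space (lebesgue_on {0<..}) \<in> sets (lebesgue_on {0<..})"
        unfolding e r by auto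
    qed
  qed
  then show ?thesis unfolding controls_def by blast
qed

lemma const_control: "c \<in> A \<Longrightarrow> (\<lambda>_. c) \<in> controls A"
  by (auto simp: controls_def)

lemma translate_Collect: "(\<lambda>t. c + t) ` {t. P t} = {t :: real. P (t - c)}"
proof (intro equalityI subsetI)
  fix t assume "t \<in> {t. P (t - c)}"
  then show "t \<in> (\<lambda>t. c + t) ` {t. P t}" by (intro image_eqI[of _ _ "t - c"]) auto
qed auto

lemma delayed_preimage_measurable:
  assumes "a \<in> controls A" "open B"
  shows "{t. s < t \<and> a (t - s) \<in> B} \<in> sets lebesgue"
proof -
  have "{t. 0 < t \<and> a t \<in> B} \<in> sets lebesgue"
    using assms unfolding controls_iff by blast
  from lebesgue_sets_translation[OF this, of s] show ?thesis
    unfolding translate_Collect by simp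
qed

lemma shift_control:
  assumes "a \<in> controls A" "0 \<le> s"
  shows "(\<lambda>t. a (s + t)) \<in> controls A"
  unfolding controls_iff
proof (intro conjI allI impI)
  fix B :: "'a set" assume "open B"
  then have "{t. 0 < t \<and> a t \<in> B} \<in> sets lebesgue"
    using assms(1) unfolding controls_iff by blast
  then have "{t. 0 < t \<and> a t \<in> B} \<inter> {s<..} \<in> sets lebesgue"
    by (rule sets.Int) simp
  moreover have "{t. 0 < t \<and> a t \<in> B} \<inter> {s<..} = {t. s < t \<and> a t \<in> B}" using assms(2) by auto
  ultimately have "{t. s < t \<and> a t \<in> B} \<in> sets lebesgue" by simp
  from lebesgue_sets_translation[OF this, of "- s"]
  show "{t. 0 < t \<and> a (s + t) \<in> B} \<in> sets lebesgue"
    unfolding translate_Collect by (simp add: add.commute)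
qed (use assms in \<open>auto simp: controls_iff\<close>)

text \<open>
  The intervals between consecutive \<open>S n\<close> are disjoint, so the pieces can be pasted; after the
  supremum of the \<open>S n\<close> the control is constant. At most one piece contributes to a given time, and
  countably many pieces keep the result measurable.
\<close>

lemma countable_concat_control:
  fixes S :: "nat \<Rightarrow> real"
  assumes b: "\<And>n. b n \<in> controls A" and S: "incseq S" "S 0 = 0"
  shows "\<exists>a\<in>controls A. \<forall>n t. S n < t \<longrightarrow> t \<le> S (Suc n) \<longrightarrow> a t = b n (t - S n)"
proof -
  define c where "c = b 0 1"
  have c: "c \<in> A" using b[of 0] by (simp add: c_def controls_iff)
  define P where "P t n \<longleftrightarrow> S n < t \<and> t \<le> S (Suc n)" for t n
  define a where "a t = (if \<exists>n. P t n then b (SOME n. P t n) (t - S (SOME n. P t n)) else c)" for t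
  have uniq: "n = m" if "P t n" "P t m" for t n m
  proof -
    have "\<not> k < l" if "P t l" "P t k" for k l
      using incseqD[OF S(1), of "Suc k" l] that by (auto simp: P_def)
    with that show ?thesis by (meson linorder_neqE_nat)
  qed
  have a_eq: "a t = b n (t - S n)" if "P t n" for t n
  proof -
    have "(SOME n. P t n) = n" using that uniq by (metis someI)
    then show ?thesis using that by (auto simp: a_def)
  qed
  have pos: "0 < t" if "P t n" for t n
    using incseqD[OF S(1), of 0 n] that S(2) by (auto simp: P_def)
  show ?thesis
  proof (rule bexI[of _ a])
    show "a \<in> controls A" unfolding controls_iff
    proof (intro conjI allI impI)
      fix t :: real
      show "a t \<in> A"
      proof (cases "\<exists>n. P t n")
        case True
        then obtain n where n: "P t n" by blast
        have "b n (t - S n) \<in> A" using b[of n] n by (simp add: P_def controls_iff)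
        with a_eq[OF n] show ?thesis by simp
      qed (simp add: a_def c)
    next
      fix B :: "'a set" assume B: "open B"
      have "{t. 0 < t \<and> a t \<in> B} =
          (\<Union>n. {S n<..S (Suc n)} \<inter> {t. S n < t \<and> b n (t - S n) \<in> B}) \<union>
          ((if c \<in> B then {0<..} else {}) - (\<Union>n. {S n<..S (Suc n)}))" (is "?X = ?Y")
      proof (intro set_eqI iffI)
        fix t assume t: "t \<in> ?X"
        show "t \<in> ?Y"
        proof (cases "\<exists>n. P t n")
          case True
          then obtain n where n: "P t n" by blast
          with a_eq[OF n] t show ?thesis by (auto simp: P_def)
        next
          case False
          then have "a t = c" "t \<notin> (\<Union>n. {S n<..S (Suc n)})" by (simp_all add: a_def) (auto simp: P_def)
          with t show ?thesis by auto
        qed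
      next
        fix t assume t: "t \<in> ?Y"
        show "t \<in> ?X"
        proof (cases "\<exists>n. P t n")
          case True
          then obtain n where n: "P t n" by blast
          have "t \<in> (\<Union>n. {S n<..S (Suc n)})" using n by (auto simp: P_def)
          with t obtain m where m: "P t m" "b m (t - S m) \<in> B" by (auto simp: P_def)
          with a_eq[OF m(1)] pos[OF m(1)] show ?thesis by simp
        next
          case False
          then have "t \<notin> (\<Union>n. {S n<..S (Suc n)})" by (auto simp: P_def)
          with t have "c \<in> B" "0 < t" by (auto split: if_splits)
          moreover have "a t = c" using False by (simp add: a_def)
          ultimately show ?thesis by simp
        qed
      qed
      also have "?Y \<in> sets lebesgue"
        by (intro sets.Un sets.Diff sets.countable_UN sets.Int image_subsetI
            delayed_preimage_measurable[OF b B]) auto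
      finally show "?X \<in> sets lebesgue" .
    qed
    show "\<forall>n t. S n < t \<longrightarrow> t \<le> S (Suc n) \<longrightarrow> a t = b n (t - S n)"
      using a_eq by (simp add: P_def)
  qed
qed

text \<open>
  The form of the integral equation that is additive in the time interval and compatible with
  translations. Absolute integrability is carried along because trajectories demand it.
\<close>

definition increment :: "(real \<Rightarrow> 'a::euclidean_space) \<Rightarrow> 'a \<Rightarrow> real \<Rightarrow> real \<Rightarrow> bool" where
  "increment G I s t \<longleftrightarrow> G absolutely_integrable_on {s..t} \<and> (G has_integral I) {s..t}"

lemma is_trajectory_iff:
  "is_trajectory F a x y \<longleftrightarrow> continuous_on {0..} y \<and> y 0 = x \<and>
     (\<forall>t\<ge>0. increment (\<lambda>s. F (y s) (a s)) (y t - x) 0 t)" (is "?L = ?R")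
proof
  assume L: ?L
  then have y: "y t = x + integral {0..t} (\<lambda>s. F (y s) (a s))"
    and i: "(\<lambda>s. F (y s) (a s)) absolutely_integrable_on {0..t}" if "t \<ge> 0" for t
    using that by (auto simp: is_trajectory_def)
  have "increment (\<lambda>s. F (y s) (a s)) (y t - x) 0 t" if t: "t \<ge> 0" for t
    using integrable_integral[OF set_lebesgue_integral_eq_integral(1)[OF i[OF t]]] i[OF t] y[OF t]
    by (simp add: increment_def)
  with L y[of 0] show ?R by (simp add: is_trajectory_def)
next
  assume ?R
  then show ?L by (auto simp: is_trajectory_def increment_def dest!: integral_unique)
qed

lemma increment_shift:
  "increment (\<lambda>u. G (u + c)) I (s - c) (t - c) \<longleftrightarrow> increment G I s t"
  unfolding increment_def absolutely_integrable_on_def integrable_on_def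
  using has_integral_shift_real_ivl_iff[of G _ s t c]
    has_integral_shift_real_ivl_iff[of "\<lambda>x. norm (G x)" _ s t c] by simp

lemma increment_join:
  assumes "increment G I r s" "increment G J s t" "r \<le> s" "s \<le> t"
  shows "increment G (I + J) r t"
  using assms unfolding increment_def
  by (auto intro: absolutely_integrable_on_combine has_integral_combine)

lemma increment_tail:
  assumes "increment G I r s" "increment G K r t" "r \<le> s" "s \<le> t"
  shows "increment G (K - I) s t"
proof -
  have a: "G absolutely_integrable_on {s..t}"
    using assms by (auto simp: increment_def intro: absolutely_integrable_on_subinterval)
  then obtain J where J: "(G has_integral J) {s..t}"
    by (auto simp: absolutely_integrable_on_def integrable_on_def)
  have "(G has_integral I + J) {r..t}"
    using has_integral_combine[OF assms(3,4) _ J] assms(1) by (simp add: increment_def)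
  with assms(2) have "K = I + J" by (auto simp: increment_def dest: has_integral_unique)
  with a J show ?thesis by (simp add: increment_def)
qed

text \<open>The left end point is a null set. At time 0 the value of a control is arbitrary.\<close>

lemma increment_cong:
  assumes "increment G I s t" "\<And>u. s < u \<Longrightarrow> u \<le> t \<Longrightarrow> G' u = G u"
  shows "increment G' I s t"
  unfolding increment_def
proof
  have eq: "G' u = G u" if "u \<in> {s..t} - {s}" for u using assms(2) that by auto
  show "G' absolutely_integrable_on {s..t}"
    by (rule absolutely_integrable_spike[where f=G and S="{s}"]) (use assms(1) eq in \<open>auto simp: increment_def\<close>)
  show "(G' has_integral I) {s..t}"
    by (rule has_integral_spike[where f=G and S="{s}"]) (use assms(1) eq in \<open>auto simp: increment_def\<close>)
qed

lemma trajectory_cong: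
  assumes "is_trajectory F a x y" "\<And>t. 0 < t \<Longrightarrow> a' t = a t"
  shows "is_trajectory F a' x y"
  using assms unfolding is_trajectory_iff by (auto intro: increment_cong)

lemma trajectory_increment:
  assumes "is_trajectory F a x y" "0 \<le> s" "s \<le> t"
  shows "increment (\<lambda>u. F (y u) (a u)) (y t - y s) s t"
proof -
  have "increment (\<lambda>u. F (y u) (a u)) (y t - x - (y s - x)) s t"
    by (rule increment_tail) (use assms in \<open>auto simp: is_trajectory_iff\<close>)
  then show ?thesis by simp
qed

lemma trajectory_shift:
  assumes y: "is_trajectory F a x y" and s: "0 \<le> s"
  shows "is_trajectory F (\<lambda>t. a (s + t)) (y s) (\<lambda>t. y (s + t))"
  unfolding is_trajectory_iff
proof (intro conjI allI impI)
  show "continuous_on {0..} (\<lambda>t. y (s + t))"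
    by (rule continuous_on_compose2[of "{0..}" y])
      (use y s in \<open>auto simp: is_trajectory_iff intro!: continuous_intros\<close>)
  fix t :: real assume "t \<ge> 0"
  then have "increment (\<lambda>u. F (y u) (a u)) (y (s + t) - y s) s (s + t)"
    using s by (intro trajectory_increment[OF y]) auto
  then show "increment (\<lambda>r. F (y (s + r)) (a (s + r))) (y (s + t) - y s) 0 t"
    using increment_shift[of "\<lambda>u. F (y u) (a u)" s _ s "s + t"] by (simp add: add.commute)
qed simp

lemma trajectory_concat:
  assumes y: "is_trajectory F a x y" and z: "is_trajectory F b (y s) z" and s: "0 \<le> s"
  shows "is_trajectory F (\<lambda>t. if t \<le> s then a t else b (t - s)) x
    (\<lambda>t. if t \<le> s then y t else z (t - s))" (is "is_trajectory F ?c x ?w")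
  unfolding is_trajectory_iff
proof (intro conjI allI impI)
  have z0: "z 0 = y s" using z by (simp add: is_trajectory_iff)
  have "continuous_on ({0..s} \<union> {s..}) ?w"
  proof (rule continuous_on_If)
    show "continuous_on {0..s} y"
      by (rule continuous_on_subset[of "{0..}"]) (use y in \<open>auto simp: is_trajectory_iff\<close>)
    show "continuous_on {s..} (\<lambda>t. z (t - s))"
      by (rule continuous_on_compose2[of "{0..}" z])
        (use z in \<open>auto simp: is_trajectory_iff intro!: continuous_intros\<close>)
  qed (use z0 in auto)
  moreover have "{0..s} \<union> {s..} = {0..}" using s by auto
  ultimately show "continuous_on {0..} ?w" by simp
  show "?w 0 = x" using y s by (simp add: is_trajectory_iff)
  fix t :: real assume t: "t \<ge> 0"
  have first: "increment (\<lambda>u. F (?w u) (?c u)) (y r - x) 0 r" if "0 \<le> r" "r \<le> s" for r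
    by (rule increment_cong[of "\<lambda>u. F (y u) (a u)"]) (use y that in \<open>auto simp: is_trajectory_iff\<close>)
  show "increment (\<lambda>u. F (?w u) (?c u)) (?w t - x) 0 t"
  proof (cases "t \<le> s")
    case True
    then show ?thesis using first[OF t] by simp
  next
    case False
    have "increment (\<lambda>u. F (z (u - s)) (b (u - s))) (z (t - s) - z 0) s t"
    proof -
      have "increment (\<lambda>u. F (z u) (b u)) (z (t - s) - z 0) 0 (t - s)"
        using z False by (simp add: is_trajectory_iff)
      then show ?thesis
        using increment_shift[of "\<lambda>u. F (z u) (b u)" "- s" _ 0 "t - s"] by simp
    qed
    then have "increment (\<lambda>u. F (?w u) (?c u)) (z (t - s) - z 0) s t"
      by (rule increment_cong) auto
    from increment_join[OF first[of s] this] show ?thesis using False s z0 by simp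
  qed
qed

lemma concat_control:
  assumes "a \<in> controls A" "b \<in> controls A" "0 \<le> s"
  shows "(\<lambda>t. if t \<le> s then a t else b (t - s)) \<in> controls A" (is "?c \<in> _")
  unfolding controls_iff
proof (intro conjI allI impI)
  fix B :: "'a set" assume "open B"
  have "{t. 0 < t \<and> ?c t \<in> B} = ({t. 0 < t \<and> a t \<in> B} \<inter> {..s}) \<union> {t. s < t \<and> b (t - s) \<in> B}"
    using assms(3) by auto
  moreover have "{t. 0 < t \<and> a t \<in> B} \<in> sets lebesgue"
    using assms(1) \<open>open B\<close> unfolding controls_iff by blast
  then have "{t. 0 < t \<and> a t \<in> B} \<inter> {..s} \<in> sets lebesgue"
    by (rule sets.Int) simp
  ultimately show "{t. 0 < t \<and> ?c t \<in> B} \<in> sets lebesgue"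
    using delayed_preimage_measurable[OF assms(2) \<open>open B\<close>] by simp
qed (use assms in \<open>auto simp: controls_iff\<close>)

text \<open>
  Whole trajectories on the half line are used here, so \<open>\<tau>\<close> is only a time at which the trajectory
  passes through \<open>z\<close>; what the control does afterwards is discarded on concatenation.
\<close>

definition reaches ::
  "(real ^ 'n \<Rightarrow> 'b::metric_space \<Rightarrow> real ^ 'n) \<Rightarrow> 'b set \<Rightarrow> real \<Rightarrow> real ^ 'n \<Rightarrow> real ^ 'n \<Rightarrow> bool"
where
  "reaches F A \<tau> x z \<longleftrightarrow>
     0 \<le> \<tau> \<and> (\<exists>a\<in>controls A. \<exists>y. is_trajectory F a x y \<and> y \<tau> = z)"

lemma reaches_trans:
  assumes "reaches F A \<sigma> x y" "reaches F A \<tau> y z"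
  shows "reaches F A (\<sigma> + \<tau>) x z"
proof -
  obtain a u where a: "a \<in> controls A" "is_trajectory F a x u" "u \<sigma> = y" "0 \<le> \<sigma>"
    using assms(1) by (auto simp: reaches_def)
  obtain b v where b: "b \<in> controls A" "is_trajectory F b y v" "v \<tau> = z" "0 \<le> \<tau>"
    using assms(2) by (auto simp: reaches_def)
  have "v 0 = y" using b(2) by (simp add: is_trajectory_iff)
  then have "(if \<sigma> + \<tau> \<le> \<sigma> then u (\<sigma> + \<tau>) else v (\<sigma> + \<tau> - \<sigma>)) = z"
    using a b by (cases "\<tau> = 0") auto
  moreover have "is_trajectory F b (u \<sigma>) v" using a b by simp
  note trajectory_concat[OF a(2) this a(4)]
  moreover note concat_control[OF a(1) b(1) a(4)]
  moreover have "0 \<le> \<sigma> + \<tau>" using a b by simp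
  ultimately show ?thesis unfolding reaches_def by blast
qed

locale well_posed_system =
  fixes F :: "real ^ 'n \<Rightarrow> 'b::metric_space \<Rightarrow> real ^ 'n" and A :: "'b set"
  assumes wp: "well_posed F A"
begin

lemma trajectory_exists: "a \<in> controls A \<Longrightarrow> \<exists>y. is_trajectory F a x y"
  using wp by (auto simp: well_posed_def)

lemma trajectory_unique:
  "a \<in> controls A \<Longrightarrow> is_trajectory F a x y \<Longrightarrow> is_trajectory F a x z \<Longrightarrow> 0 \<le> t \<Longrightarrow> y t = z t"
  using wp unfolding well_posed_def by blast

lemma reaches_refl:
  assumes "A \<noteq> {}"
  shows "reaches F A 0 x x"
proof -
  obtain c where "c \<in> A" using assms by blast
  then have c: "(\<lambda>_. c) \<in> controls A" by (rule const_control)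
  with trajectory_exists obtain y where "is_trajectory F (\<lambda>_. c) x y" by blast
  moreover from this have "y 0 = x" by (simp add: is_trajectory_iff)
  ultimately show ?thesis using c unfolding reaches_def by blast
qed

text \<open>
  Uniqueness is available for one control on the whole half line only. The first trajectory, stopped
  at time \<open>s\<close> and continued with the second control, is a trajectory of the second control, which
  gives uniqueness up to time \<open>s\<close>.
\<close>

lemma trajectory_causal:
  assumes a: "a \<in> controls A" "is_trajectory F a x y"
    and b: "b \<in> controls A" "is_trajectory F b x z"
    and eq: "\<And>t. 0 < t \<Longrightarrow> t \<le> s \<Longrightarrow> a t = b t" and s: "0 \<le> s"
  shows "y s = z s"
proof -
  obtain w where w: "is_trajectory F (\<lambda>t. b (s + t)) (y s) w"
    using trajectory_exists[OF shift_control[OF b(1) s]] by blast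
  have "is_trajectory F b x (\<lambda>t. if t \<le> s then y t else w (t - s))"
    by (rule trajectory_cong[OF trajectory_concat[OF a(2) w s]]) (use eq in auto)
  from trajectory_unique[OF b(1) this b(2) s] show ?thesis by simp
qed

text \<open>
  Infinitely many controls with summable durations can be used one after the other. Existence provides
  a trajectory \<open>w\<close> of the pasted control, causality identifies it with the given pieces, and its
  continuity at the accumulation time forces it into the limit of the points passed.
\<close>

lemma reaches_limit:
  assumes r: "\<And>n. reaches F A (\<tau> n) (x n) (x (Suc n))"
    and \<tau>: "summable \<tau>" and x: "x \<longlonglongrightarrow> z"
  shows "reaches F A (suminf \<tau>) (x 0) z"
proof -
  have \<tau>_nonneg: "0 \<le> \<tau> n" for n using r by (simp add: reaches_def)
  have "\<forall>n. \<exists>b. \<exists>y. b \<in> controls A \<and> is_trajectory F b (x n) y \<and> y (\<tau> n) = x (Suc n)"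
    using r unfolding reaches_def by blast
  from choice[OF this] obtain b where
    "\<forall>n. \<exists>y. b n \<in> controls A \<and> is_trajectory F (b n) (x n) y \<and> y (\<tau> n) = x (Suc n)" by blast
  from choice[OF this] obtain y where b: "\<And>n. b n \<in> controls A"
    and y: "\<And>n. is_trajectory F (b n) (x n) (y n)" "\<And>n. y n (\<tau> n) = x (Suc n)"
    by blast
  define S where "S n = sum \<tau> {..<n}" for n
  have S: "incseq S" "S 0 = 0" "S (Suc n) = S n + \<tau> n" for n
    using \<tau>_nonneg by (auto simp: S_def incseq_Suc_iff)
  have S_nonneg: "0 \<le> S n" for n using incseqD[OF S(1), of 0 n] S(2) by simp
  obtain a where a: "a \<in> controls A" "\<And>n t. S n < t \<Longrightarrow> t \<le> S (Suc n) \<Longrightarrow> a t = b n (t - S n)"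
    using countable_concat_control[of b A S, OF b S(1,2)] by blast
  obtain w where w: "is_trajectory F a (x 0) w" using trajectory_exists[OF a(1)] by blast
  have wS: "w (S n) = x n" for n
  proof (induction n)
    case 0
    then show ?case using w S(2) by (simp add: is_trajectory_iff)
  next
    case (Suc n)
    have "is_trajectory F (\<lambda>t. a (S n + t)) (x n) (\<lambda>t. w (S n + t))"
      using trajectory_shift[OF w S_nonneg[of n]] Suc.IH by simp
    then have "w (S n + \<tau> n) = y n (\<tau> n)"
      by (rule trajectory_causal[OF shift_control[OF a(1) S_nonneg] _ b y(1)])
        (use a(2)[of n] S(3)[of n] \<tau>_nonneg[of n] in simp_all)
    then show ?case unfolding S(3) y(2) .
  qed
  have "S \<longlonglongrightarrow> suminf \<tau>" using summable_LIMSEQ[OF \<tau>] by (simp add: S_def[abs_def])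
  moreover have nn: "0 \<le> suminf \<tau>" using \<tau>_nonneg \<tau> by (rule suminf_nonneg[rotated])
  moreover have "continuous_on {0..} w" using w by (simp add: is_trajectory_iff)
  ultimately have "(\<lambda>n. w (S n)) \<longlonglongrightarrow> w (suminf \<tau>)"
    using S_nonneg by (intro continuous_on_tendsto_compose[where s="{0..}" and f=w]) auto
  then have "w (suminf \<tau>) = z" using x unfolding wS by (rule LIMSEQ_unique)
  with a(1) w nn show ?thesis unfolding reaches_def by blast
qed

end

lemma min_time_le:
  assumes "reaches F A \<tau> x z"
  shows "min_time F A {z} x \<le> ennreal \<tau>"
proof -
  obtain a y where a: "a \<in> controls A" "is_trajectory F a x y" "y \<tau> = z" "0 \<le> \<tau>"
    using assms by (auto simp: reaches_def)
  then have "hitting_time F {z} x a \<le> ennreal \<tau>"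
    unfolding hitting_time_def by (intro Inf_lower) auto
  then show ?thesis unfolding min_time_def using a(1) by (rule INF_lower2[rotated])
qed

text \<open>The infimum need not be attained, but every larger time leaves room for an actual arrival.\<close>

lemma reaches_before:
  assumes "min_time F A {z} x < ennreal T"
  obtains \<tau> where "\<tau> < T" "reaches F A \<tau> x z"
proof -
  from assms obtain a where a: "a \<in> controls A" "hitting_time F {z} x a < ennreal T"
    unfolding min_time_def by (auto simp: INF_less_iff)
  then obtain \<tau> y where "0 \<le> \<tau>" "is_trajectory F a x y" "y \<tau> = z" "ennreal \<tau> < ennreal T"
    unfolding hitting_time_def by (auto simp: Inf_less_iff)
  with a(1) that[of \<tau>] show ?thesis by (auto simp: reaches_def ennreal_less_iff)
qed

text \<open>
  The right-hand side of the integral inequality, multiplied by \<open>exp (- L * t)\<close>, is nonincreasing.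
\<close>

lemma gronwall:
  fixes d :: "real \<Rightarrow> real"
  assumes d: "continuous_on {0..T} d" and T: "0 \<le> T" and L: "0 \<le> L"
    and le: "\<And>t. t \<in> {0..T} \<Longrightarrow> d t \<le> c + L * integral {0..t} d"
  shows "d T \<le> c * exp (L * T)"
proof -
  define G where "G t = (c + L * integral {0..t} d) * exp (- L * t)" for t
  have "G T \<le> G 0"
  proof (rule DERIV_nonpos_imp_decreasing_open[where f=G and a=0 and b=T])
    fix t assume t: "0 < t" "t < T"
    have "((\<lambda>t. integral {0..t} d) has_real_derivative d t) (at t within {0..T})"
      using t by (intro integral_has_real_derivative d) auto
    then have "((\<lambda>t. integral {0..t} d) has_real_derivative d t) (at t)"
      using t by (simp add: at_within_Icc_at)
    then have "(G has_real_derivative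
        L * (d t - (c + L * integral {0..t} d)) * exp (- L * t)) (at t)"
      unfolding G_def[abs_def] by (auto intro!: derivative_eq_intros simp: algebra_simps)
    moreover have "L * (d t - (c + L * integral {0..t} d)) * exp (- L * t) \<le> 0"
      using le[of t] t L by (intro mult_nonpos_nonneg mult_nonneg_nonpos) auto
    ultimately show "\<exists>D. (G has_real_derivative D) (at t) \<and> D \<le> 0" by blast
  next
    show "continuous_on {0..T} G"
      unfolding G_def[abs_def]
      by (intro continuous_intros indefinite_integral_continuous_1 integrable_continuous_real d)
  qed (rule T)
  then have "c + L * integral {0..T} d \<le> c * exp (L * T)"
    by (simp add: G_def exp_minus field_simps)
  with le[of T] T show ?thesis by auto
qed

lemma trajectory_integrable:
  assumes "is_trajectory F a x y" "0 \<le> t"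
  shows "((\<lambda>s. F (y s) (a s)) has_integral (y t - x)) {0..t}"
  using assms by (simp add: is_trajectory_iff increment_def)

text \<open>
  The second estimate is the one that matters for small times: the difference of two displacements
  under the same control carries an additional factor \<open>T\<close>.
\<close>

lemma trajectory_dependence:
  assumes y: "is_trajectory F a x y" and z: "is_trajectory F a x' z"
    and S: "\<And>s. s \<in> {0..T} \<Longrightarrow> y s \<in> S \<and> z s \<in> S"
    and lip: "\<And>u v s. u \<in> S \<Longrightarrow> v \<in> S \<Longrightarrow> 0 < s \<Longrightarrow> norm (F u (a s) - F v (a s)) \<le> L * norm (u - v)"
    and T: "0 \<le> T" and L: "0 \<le> L"
  shows "norm (y T - z T) \<le> exp (L * T) * norm (x - x')"
    and "norm ((y T - x) - (z T - x')) \<le> L * T * exp (L * T) * norm (x - x')"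
proof -
  define d where "d t = norm (y t - z t)" for t
  have cont: "continuous_on {0..T} d"
    unfolding d_def[abs_def]
    by (intro continuous_intros; rule continuous_on_subset[of "{0..}"])
      (use y z in \<open>auto simp: is_trajectory_iff\<close>)
  have diff: "norm ((y t - x) - (z t - x')) \<le> L * integral {0..t} d" if t: "t \<in> {0..T}" for t
  proof -
    have dt: "continuous_on {0..t} d"
      by (rule continuous_on_subset[OF cont]) (use t in auto)
    have "((\<lambda>s. F (y s) (a s) - F (z s) (a s)) has_integral ((y t - x) - (z t - x'))) {0..t}"
      using t by (intro has_integral_diff trajectory_integrable[OF y] trajectory_integrable[OF z]) auto
    \<comment> \<open>The control may take a value outside the control set at time 0, so the bound is needed for positive times only.\<close>
    then have I: "((\<lambda>s. if s = 0 then 0 else F (y s) (a s) - F (z s) (a s)) has_integral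
        ((y t - x) - (z t - x'))) {0..t}"
      by (rule has_integral_spike[where S="{0}", rotated 2]) auto
    have "norm ((y t - x) - (z t - x')) \<le> integral {0..t} (\<lambda>s. L * d s)"
      unfolding integral_unique[OF I, symmetric]
    proof (rule integral_norm_bound_integral)
      show "(\<lambda>s. L * d s) integrable_on {0..t}"
        by (intro integrable_continuous_real continuous_intros dt)
      show "norm (if s = 0 then 0 else F (y s) (a s) - F (z s) (a s)) \<le> L * d s"
        if "s \<in> {0..t}" for s
        using that t S[of s] lip[of "y s" "z s" s] L by (auto simp: d_def)
    qed (use I in blast)
    then show ?thesis by simp
  qed
  have "d t \<le> norm (x - x') + L * integral {0..t} d" if "t \<in> {0..T}" for t
  proof -
    have "y t - z t = (x - x') + ((y t - x) - (z t - x'))" by simp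
    then have "d t \<le> norm (x - x') + norm ((y t - x) - (z t - x'))"
      unfolding d_def by (metis norm_triangle_ineq)
    with diff[OF that] show ?thesis by linarith
  qed
  note gr = this
  have bound: "d t \<le> norm (x - x') * exp (L * t)" if t: "t \<in> {0..T}" for t
    by (rule gronwall[OF _ _ L gr]) (use t in \<open>auto intro: continuous_on_subset[OF cont]\<close>)
  show "norm (y T - z T) \<le> exp (L * T) * norm (x - x')"
    using bound[of T] T by (simp add: d_def mult.commute)
  have "integral {0..T} d \<le> integral {0..T} (\<lambda>_. norm (x - x') * exp (L * T))"
  proof (rule integral_le)
    show "d t \<le> norm (x - x') * exp (L * T)" if t: "t \<in> {0..T}" for t
    proof -
      have "norm (x - x') * exp (L * t) \<le> norm (x - x') * exp (L * T)"
        using t L by (intro mult_left_mono) (auto intro: mult_left_mono)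
      with bound[OF t] show ?thesis by linarith
    qed
  qed (auto intro: integrable_continuous_real cont)
  also have "\<dots> = T * exp (L * T) * norm (x - x')" using T by simp
  finally have "L * integral {0..T} d \<le> L * (T * exp (L * T) * norm (x - x'))"
    using L by (rule mult_left_mono)
  with diff[of T] T show "norm ((y T - x) - (z T - x')) \<le> L * T * exp (L * T) * norm (x - x')"
    by (simp add: mult.assoc)
qed

text \<open>
  A bound on the speed inside the ball suffices: up to the first exit time the displacement is at most
  \<open>M * T\<close>, which is too little to exit.
\<close>

lemma trajectory_stays_in_ball:
  assumes y: "is_trajectory F a x y"
    and bd: "\<And>u s. u \<in> cball p R \<Longrightarrow> 0 < s \<Longrightarrow> norm (F u (a s)) \<le> M"
    and M: "0 \<le> M" and T: "0 \<le> T" and small: "dist p x + M * T < R"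
  shows "y T \<in> cball p R" and "norm (y T - x) \<le> M * T"
proof -
  have inc: "norm (y t - x) \<le> M * t"
    if t: "0 \<le> t" and in_ball: "\<And>s. 0 \<le> s \<Longrightarrow> s < t \<Longrightarrow> y s \<in> cball p R" for t
  proof -
    have I: "((\<lambda>s. F (y s) (a s)) has_integral (y t - x)) {0..t}"
      using trajectory_integrable[OF y t] .
    have "norm (y t - x) \<le> M * measure lborel {0..t}"
    proof (rule has_integral_bound_real[OF M _ I, of "{0, t}"])
      show "norm (F (y s) (a s)) \<le> M" if "s \<in> {0..t} - {0, t}" for s
        using that by (intro bd in_ball) auto
    qed simp
    then show ?thesis using t by simp
  qed
  have cont: "continuous_on {0..T} (\<lambda>t. dist p (y t))"
    by (intro continuous_intros; rule continuous_on_subset[of "{0..}"])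
      (use y in \<open>auto simp: is_trajectory_iff\<close>)
  have dist_le: "dist p (y t) < R"
    if "0 \<le> t" "t \<le> T" "\<And>s. 0 \<le> s \<Longrightarrow> s < t \<Longrightarrow> y s \<in> cball p R" for t
  proof -
    have "dist p (y t) \<le> dist p x + norm (y t - x)"
      using dist_triangle[of p "y t" x] by (simp add: dist_norm norm_minus_commute)
    moreover have "M * t \<le> M * T" using that M by (intro mult_left_mono) auto
    ultimately show ?thesis using inc[OF that(1,3)] small by linarith
  qed
  have stay: "dist p (y t) < R" if t: "t \<in> {0..T}" for t
  proof (rule ccontr)
    assume "\<not> dist p (y t) < R"
    \<comment> \<open>The minimum of \<open>E\<close> is the first exit time.\<close>
    define E where "E = {t \<in> {0..T}. dist p (y t) \<ge> R}"
    have "E \<noteq> {}" using t \<open>\<not> dist p (y t) < R\<close> by (auto simp: E_def)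
    moreover have "compact E"
    proof -
      have "closed E" unfolding E_def
        by (rule continuous_on_closed_Collect_le[OF continuous_on_const cont]) simp
      moreover have "bounded E" by (rule bounded_subset[of "{0..T}"]) (auto simp: E_def)
      ultimately show ?thesis by (simp add: compact_eq_bounded_closed)
    qed
    ultimately obtain m where m: "m \<in> E" "\<And>s. s \<in> E \<Longrightarrow> m \<le> s"
      using compact_attains_inf[of E] by blast
    have "dist p (y m) < R"
    proof (rule dist_le)
      show "y s \<in> cball p R" if "0 \<le> s" "s < m" for s
      proof -
        have "s \<notin> E" using m(2)[of s] that by linarith
        moreover have "s \<le> T" using m(1) that by (simp add: E_def)
        ultimately show ?thesis using that by (simp add: E_def)
      qed
    qed (use m(1) in \<open>auto simp: E_def\<close>)
    then show False using m(1) by (auto simp: E_def)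
  qed
  show "y T \<in> cball p R" using stay[of T] T by auto
  show "norm (y T - x) \<le> M * T"
  proof (rule inc[OF T])
    show "y s \<in> cball p R" if "0 \<le> s" "s < T" for s using stay[of s] that by auto
  qed
qed

section \<open>Flows of available fields\<close>

locale locally_lipschitz_system = well_posed_system F A
  for F :: "real ^ 'n \<Rightarrow> 'b::metric_space \<Rightarrow> real ^ 'n" and A :: "'b set" +
  fixes p :: "real ^ 'n" and R L :: real
  assumes A_compact: "compact A"
    and F_cont: "continuous_on (UNIV \<times> A) (\<lambda>(x, a). F x a)"
    and R_pos: "R > 0" and L_pos: "L > 0"
    and F_lipschitz: "\<And>x y a. \<lbrakk>x \<in> cball p R; y \<in> cball p R; a \<in> A\<rbrakk>
                        \<Longrightarrow> norm (F x a - F y a) \<le> L * norm (x - y)"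
begin

definition speed :: real where
  "speed = (SOME M. 0 \<le> M \<and> (\<forall>x\<in>cball p R. \<forall>a\<in>A. norm (F x a) \<le> M))"

lemma speed_nonneg: "0 \<le> speed"
  and speed_bound: "\<And>x a. x \<in> cball p R \<Longrightarrow> a \<in> A \<Longrightarrow> norm (F x a) \<le> speed"
proof -
  have "compact ((\<lambda>(x, a). F x a) ` (cball p R \<times> A))"
    using A_compact by (intro compact_continuous_image continuous_on_subset[OF F_cont] compact_Times) auto
  then obtain M where M: "\<forall>z \<in> (\<lambda>(x, a). F x a) ` (cball p R \<times> A). norm z \<le> M"
    by (auto dest!: compact_imp_bounded simp: bounded_iff)
  have "norm (F x a) \<le> max 0 M" if "x \<in> cball p R" "a \<in> A" for x a
  proof -
    have "F x a \<in> (\<lambda>(x, a). F x a) ` (cball p R \<times> A)"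
      using that by (intro image_eqI[of _ _ "(x, a)"]) auto
    from bspec[OF M this] show ?thesis by simp
  qed
  then have "0 \<le> max 0 M \<and> (\<forall>x\<in>cball p R. \<forall>a\<in>A. norm (F x a) \<le> max 0 M)"
    by simp
  then have "0 \<le> speed \<and> (\<forall>x\<in>cball p R. \<forall>a\<in>A. norm (F x a) \<le> speed)"
    unfolding speed_def by (rule someI)
  then show "0 \<le> speed" "\<And>x a. x \<in> cball p R \<Longrightarrow> a \<in> A \<Longrightarrow> norm (F x a) \<le> speed"
    by simp_all
qed

text \<open>
  The control value that realises the field is fixed along with the trajectory; by uniqueness the
  choice does not affect nonnegative times.
\<close>

definition flow :: "'n vfield \<Rightarrow> real ^ 'n \<Rightarrow> real \<Rightarrow> real ^ 'n" where
  "flow g x = (SOME y. \<exists>c\<in>A. (\<forall>z. g z = F z c) \<and> is_trajectory F (\<lambda>_. c) x y)"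

lemma flow_trajectory:
  assumes "available F A g"
  obtains c where "c \<in> A" "g = (\<lambda>z. F z c)" "is_trajectory F (\<lambda>_. c) x (flow g x)"
proof -
  obtain c where c: "c \<in> A" "\<forall>z. g z = F z c" using assms by (auto simp: available_def)
  obtain y where "is_trajectory F (\<lambda>_. c) x y"
    using trajectory_exists[OF const_control[OF c(1)]] by blast
  with c have "\<exists>y. \<exists>c\<in>A. (\<forall>z. g z = F z c) \<and> is_trajectory F (\<lambda>_. c) x y" by blast
  then have "\<exists>c\<in>A. (\<forall>z. g z = F z c) \<and> is_trajectory F (\<lambda>_. c) x (flow g x)"
    unfolding flow_def by (rule someI_ex)
  then obtain c where "c \<in> A" "\<forall>z. g z = F z c" "is_trajectory F (\<lambda>_. c) x (flow g x)"
    by blast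
  moreover from this(2) have "g = (\<lambda>z. F z c)" by (intro ext) simp
  ultimately show ?thesis by (intro that)
qed

lemma flow_reaches:
  assumes "available F A g" "0 \<le> t"
  shows "reaches F A t x (flow g x t)"
proof -
  from assms(1) obtain c where "c \<in> A" "is_trajectory F (\<lambda>_. c) x (flow g x)"
    by (rule flow_trajectory)
  with assms(2) show ?thesis unfolding reaches_def using const_control by blast
qed

lemma flow_0:
  assumes "available F A g"
  shows "flow g x 0 = x"
proof -
  from assms obtain c where "is_trajectory F (\<lambda>_. c) x (flow g x)"
    by (rule flow_trajectory)
  then show ?thesis by (simp add: is_trajectory_iff)
qed

lemma flow_has_derivative:
  assumes g: "available F A g" and s: "s \<in> {0..t}"
  shows "(flow g x has_vector_derivative g (flow g x s)) (at s within {0..t})"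
proof -
  from g obtain c where c: "c \<in> A" "g = (\<lambda>z. F z c)" "is_trajectory F (\<lambda>_. c) x (flow g x)"
    by (rule flow_trajectory)
  have "continuous_on UNIV (\<lambda>z. F z c)"
    by (rule continuous_on_compose2[OF F_cont, of _ "\<lambda>z. (z, c)", simplified])
      (use c(1) in \<open>auto intro!: continuous_intros\<close>)
  moreover have "continuous_on {0..t} (flow g x)"
    by (rule continuous_on_subset[of "{0..}"]) (use c(3) in \<open>auto simp: is_trajectory_iff\<close>)
  ultimately have "continuous_on {0..t} (\<lambda>s. F (flow g x s) c)"
    by (rule continuous_on_compose2) simp
  from integral_has_vector_derivative[OF this s]
  have "((\<lambda>r. x + integral {0..r} (\<lambda>s. F (flow g x s) c)) has_vector_derivative F (flow g x s) c)
      (at s within {0..t})"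
    by (auto intro!: derivative_eq_intros)
  then have "(flow g x has_vector_derivative F (flow g x s) c) (at s within {0..t})"
    by (rule has_vector_derivative_transform[OF s, rotated])
      (use c(3) in \<open>auto simp: is_trajectory_def\<close>)
  moreover have "g (flow g x s) = F (flow g x s) c"
    by (rule fun_cong[OF c(2)])
  ultimately show ?thesis by simp
qed

lemma flow_near:
  assumes g: "available F A g" and t: "0 \<le> t" and small: "dist p x + speed * t < R"
  shows "flow g x t \<in> cball p R" "norm (flow g x t - x) \<le> speed * t"
proof -
  from g obtain c where c: "c \<in> A" "is_trajectory F (\<lambda>_. c) x (flow g x)"
    by (rule flow_trajectory)
  show "flow g x t \<in> cball p R" "norm (flow g x t - x) \<le> speed * t"
    using trajectory_stays_in_ball[OF c(2) speed_bound[OF _ c(1)] speed_nonneg t small] by auto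
qed

text \<open>Both displacements stay in the ball where the fields are Lipschitz, so \<open>trajectory_dependence\<close> applies.\<close>

lemma flow_displacement_lipschitz:
  assumes g: "available F A g" and t: "0 \<le> t" "t \<le> 1"
    and x: "dist p x + speed * t < R" and y: "dist p y + speed * t < R"
  shows "norm ((flow g x t - x) - (flow g y t - y)) \<le> L * exp L * t * norm (x - y)"
proof -
  obtain c where c: "c \<in> A" "g = (\<lambda>z. F z c)" "is_trajectory F (\<lambda>_. c) x (flow g x)"
    using g by (rule flow_trajectory)
  obtain c' where c': "c' \<in> A" "g = (\<lambda>z. F z c')" "is_trajectory F (\<lambda>_. c') y (flow g y)"
    using g by (rule flow_trajectory)
  \<comment> \<open>The two starting points may have chosen different control values for the same field.\<close>
  have "F z c' = F z c" for z using fun_cong[OF c(2), of z] fun_cong[OF c'(2), of z] by simp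
  then have y_traj: "is_trajectory F (\<lambda>_. c) y (flow g y)"
    using c'(3) unfolding is_trajectory_def by simp
  have "norm ((flow g x t - x) - (flow g y t - y)) \<le> L * t * exp (L * t) * norm (x - y)"
  proof (rule trajectory_dependence(2)[OF c(3) y_traj])
    show "flow g x s \<in> cball p R \<and> flow g y s \<in> cball p R" if s: "s \<in> {0..t}" for s
    proof -
      have "speed * s \<le> speed * t" using s speed_nonneg by (intro mult_left_mono) auto
      with s x y g show ?thesis by (intro conjI flow_near(1)) auto
    qed
  qed (use F_lipschitz c(1) t L_pos in auto)
  also have "\<dots> \<le> L * t * exp L * norm (x - y)"
    using t L_pos by (intro mult_right_mono mult_left_mono) auto
  finally show ?thesis by (simp add: mult_ac)
qed

text \<open>
  The head of the list is followed first. As an operator on functions it then stands outermost, in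
  accordance with the order in \<^const>\<open>H_comp\<close>.
\<close>

primrec group_flow :: "'n vfield list \<Rightarrow> real ^ 'n \<Rightarrow> real \<Rightarrow> real ^ 'n" where
  "group_flow [] x t = x"
| "group_flow (g # gs) x t = group_flow gs (flow g x t) t"

lemma group_flow_0: "(\<And>g. g \<in> set gs \<Longrightarrow> available F A g) \<Longrightarrow> group_flow gs x 0 = x"
  by (induction gs arbitrary: x) (auto simp: flow_0)

lemma group_flow_reaches:
  fixes t :: real
  assumes "A \<noteq> {}" "\<And>g. g \<in> set gs \<Longrightarrow> available F A g" "0 \<le> t"
  shows "reaches F A (length gs * t) x (group_flow gs x t)"
  using assms(2)
proof (induction gs arbitrary: x)
  case Nil
  then show ?case using reaches_refl[OF assms(1)] by simp
next
  case (Cons g gs)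
  have "reaches F A (t + length gs * t) x (group_flow gs (flow g x t) t)"
    using Cons.prems by (intro reaches_trans[OF flow_reaches[OF _ assms(3)] Cons.IH]) auto
  then show ?case by (simp add: algebra_simps)
qed

text \<open>
  The factor \<open>t\<close> survives composition since the displacement of a composition is the sum of the
  displacements, and the intermediate points are Lipschitz functions of the initial ones.
\<close>

lemma group_flow_displacement_lipschitz:
  assumes "\<And>g. g \<in> set gs \<Longrightarrow> available F A g"
  shows "\<exists>K>0. \<exists>r>0. \<forall>t x y. 0 \<le> t \<longrightarrow> t \<le> r \<longrightarrow> x \<in> cball p r \<longrightarrow> y \<in> cball p r \<longrightarrow>
    norm ((group_flow gs x t - x) - (group_flow gs y t - y)) \<le> K * t * norm (x - y)"
  using assms
proof (induction gs)
  case Nil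
  show ?case
    by (rule exI[of _ 1], rule conjI, simp, rule exI[of _ 1]) simp
next
  case (Cons g gs)
  have "\<exists>K>0. \<exists>r>0. \<forall>t x y. 0 \<le> t \<longrightarrow> t \<le> r \<longrightarrow> x \<in> cball p r \<longrightarrow> y \<in> cball p r \<longrightarrow>
    norm ((group_flow gs x t - x) - (group_flow gs y t - y)) \<le> K * t * norm (x - y)"
    using Cons by auto
  then obtain K r where K: "K > 0" and r: "r > 0" and IH:
    "\<And>t x y. 0 \<le> t \<Longrightarrow> t \<le> r \<Longrightarrow> x \<in> cball p r \<Longrightarrow> y \<in> cball p r \<Longrightarrow>
       norm ((group_flow gs x t - x) - (group_flow gs y t - y)) \<le> K * t * norm (x - y)"
    by blast
  have g: "available F A g" using Cons.prems by simp
  define K1 where "K1 = L * exp L"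
  have K1: "K1 > 0" using L_pos by (simp add: K1_def)
  \<comment> \<open>Small enough that the first flow stays where \<open>g\<close> is Lipschitz and ends where the induction hypothesis holds.\<close>
  define r1 where "r1 = min 1 (min (R / (2 * (1 + speed))) (r / (1 + speed)))"
  have sp: "1 + speed > 0" using speed_nonneg by simp
  have r1: "r1 > 0" "r1 \<le> 1" using R_pos r sp by (auto simp: r1_def)
  have "r1 \<le> R / (2 * (1 + speed))" "r1 \<le> r / (1 + speed)" by (auto simp: r1_def)
  then have "(1 + speed) * r1 \<le> R / 2" and r1r: "(1 + speed) * r1 \<le> r"
    using sp by (auto simp: field_simps)
  then have r1R: "(1 + speed) * r1 < R" using R_pos by linarith
  have "1 * r1 \<le> (1 + speed) * r1" using r1(1) speed_nonneg by (intro mult_right_mono) auto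
  with r1r have r1r': "r1 \<le> r" by linarith
  show ?case
  proof (intro exI conjI allI impI)
    show "0 < K * (1 + K1) + K1" using K K1 by (simp add: add_pos_pos)
    show "0 < r1" by (rule r1)
    fix t x y assume t: "0 \<le> t" "t \<le> r1" and x: "x \<in> cball p r1" and y: "y \<in> cball p r1"
    have spt: "speed * t \<le> speed * r1" using t speed_nonneg by (intro mult_left_mono) auto
    have small: "dist p z + speed * t \<le> (1 + speed) * r1" if "z \<in> cball p r1" for z
      using that spt by (simp add: algebra_simps)
    have in_r: "flow g z t \<in> cball p r" if z: "z \<in> cball p r1" for z
    proof -
      have "norm (flow g z t - z) \<le> speed * t"
        using small[OF z] r1R by (intro flow_near(2)[OF g t(1)]) auto
      moreover have "dist p (flow g z t) \<le> dist p z + norm (flow g z t - z)"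
        using dist_triangle[of p "flow g z t" z] by (simp add: dist_norm norm_minus_commute)
      ultimately show ?thesis using small[OF z] r1r by simp
    qed
    let ?x = "flow g x t" and ?y = "flow g y t"
    have D1: "norm ((?x - x) - (?y - y)) \<le> K1 * t * norm (x - y)"
      unfolding K1_def using small[OF x] small[OF y] r1R r1 t
      by (intro flow_displacement_lipschitz[OF g]) auto
    have "norm (?x - ?y) \<le> norm (x - y) + norm ((?x - x) - (?y - y))"
      using norm_triangle_ineq[of "x - y" "(?x - x) - (?y - y)"] by simp
    also have "\<dots> \<le> norm (x - y) + K1 * 1 * norm (x - y)"
    proof -
      have "K1 * t * norm (x - y) \<le> K1 * 1 * norm (x - y)"
        using K1 t r1 by (intro mult_right_mono mult_left_mono) auto
      with D1 show ?thesis by linarith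
    qed
    finally have xy: "norm (?x - ?y) \<le> (1 + K1) * norm (x - y)" by (simp add: algebra_simps)
    have "norm ((group_flow gs ?x t - ?x) - (group_flow gs ?y t - ?y)) \<le> K * t * norm (?x - ?y)"
      using t r1r' in_r[OF x] in_r[OF y] by (intro IH) auto
    also have "\<dots> \<le> K * t * ((1 + K1) * norm (x - y))"
      using K t xy by (intro mult_left_mono) auto
    finally have D2: "norm ((group_flow gs ?x t - ?x) - (group_flow gs ?y t - ?y))
        \<le> K * t * ((1 + K1) * norm (x - y))" .
    have "norm ((group_flow (g # gs) x t - x) - (group_flow (g # gs) y t - y)) \<le>
        norm ((group_flow gs ?x t - ?x) - (group_flow gs ?y t - ?y)) + norm ((?x - x) - (?y - y))"
      by (rule order_trans[OF eq_refl norm_triangle_ineq], rule arg_cong[where f=norm]) simp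
    then show "norm ((group_flow (g # gs) x t - x) - (group_flow (g # gs) y t - y)) \<le>
        (K * (1 + K1) + K1) * t * norm (x - y)"
      using D1 D2 by (simp add: algebra_simps)
  qed
qed

section \<open>The leading term of the flow of a group\<close>

lemma eventually_near:
  assumes y: "(y \<longlongrightarrow> p) (at_right (0::real))" and d: "d > 0"
  shows "eventually (\<lambda>t. 0 < t \<and> dist p (y t) + speed * t < d) (at_right 0)"
proof -
  have "((\<lambda>t. dist p (y t) + speed * t) \<longlongrightarrow> dist p p + speed * 0) (at_right 0)"
    by (intro tendsto_intros y)
  then have "eventually (\<lambda>t. dist p (y t) + speed * t < d) (at_right 0)"
    using d by (intro order_tendstoD(2)) auto
  then show ?thesis using eventually_at_right_less[of "0::real"] by eventually_elim auto
qed

lemma flow_tendsto: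
  assumes g: "available F A g" and y: "(y \<longlongrightarrow> p) (at_right 0)"
  shows "((\<lambda>t. flow g (y t) t) \<longlongrightarrow> p) (at_right 0)"
proof (rule tendstoI)
  fix e :: real assume "e > 0"
  then have "0 < min e R" using R_pos by simp
  from eventually_near[OF y this] show "eventually (\<lambda>t. dist (flow g (y t) t) p < e) (at_right 0)"
  proof eventually_elim
    case (elim t)
    then have "norm (flow g (y t) t - y t) \<le> speed * t" by (intro flow_near(2)[OF g]) auto
    moreover have "dist (flow g (y t) t) p \<le> dist p (y t) + norm (flow g (y t) t - y t)"
      using dist_triangle[of p "flow g (y t) t" "y t"] by (simp add: dist_norm norm_minus_commute)
    ultimately show ?case using elim by simp
  qed
qed

text \<open>
  The expansion is uniform near \<open>p\<close>. Uniformity is expressed by letting the starting point \<open>y t\<close> run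
  into \<open>p\<close> in an arbitrary way as \<open>t\<close> tends to 0, which is the form in which compositions of flows
  can be expanded.
\<close>

lemma flow_expansion:
  assumes g: "available F A g" "Ck (q - 1) g" and u: "Ck q u" and y: "(y \<longlongrightarrow> p) (at_right 0)"
  shows "((\<lambda>t. (u (flow g (y t) t) - (\<Sum>s\<le>q. t ^ s / fact s * (H g ^^ s) u (y t))) / t ^ q)
    \<longlongrightarrow> 0) (at_right 0)"
proof (rule tendstoI)
  fix e :: real assume e: "e > 0"
  let ?w = "(H g ^^ q) u"
  have "Ck 0 ?w" using u g(2) by (intro Ck_H_power) auto
  then have "isCont ?w p" by (simp add: continuous_on_eq_continuous_at)
  moreover have "0 < e / 4" using e by simp
  ultimately obtain d where d: "d > 0" "\<And>z. dist z p < d \<Longrightarrow> dist (?w z) (?w p) < e / 4"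
    unfolding continuous_at_eps_delta by blast
  have "0 < min d R" using d R_pos by simp
  from eventually_near[OF y this]
  show "eventually (\<lambda>t. dist ((u (flow g (y t) t) -
      (\<Sum>s\<le>q. t ^ s / fact s * (H g ^^ s) u (y t))) / t ^ q) 0 < e) (at_right 0)"
  proof eventually_elim
    case (elim t)
    then have t: "0 < t" by simp
    let ?y = "flow g (y t)"
    have near: "dist (?w (?y s)) (?w p) < e / 4" if s: "s \<in> {0..t}" for s
    proof -
      have "speed * s \<le> speed * t" using s speed_nonneg by (intro mult_left_mono) auto
      then have small: "dist p (y t) + speed * s < min d R" using elim by linarith
      then have "norm (?y s - y t) \<le> speed * s" using s by (intro flow_near(2)[OF g(1)]) auto
      moreover have "dist (?y s) p \<le> dist p (y t) + norm (?y s - y t)"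
        using dist_triangle[of p "?y s" "y t"] by (simp add: dist_norm norm_minus_commute)
      ultimately show ?thesis using small by (intro d(2)) simp
    qed
    have "\<bar>u (?y t) - (\<Sum>s\<le>q. t ^ s / fact s * (H g ^^ s) u (?y 0))\<bar> \<le> (e / 2) * t ^ q"
    proof (rule Taylor_along_curve[OF u g(2)])
      show "(?y has_vector_derivative g (?y s)) (at s within {0..t})" if "s \<in> {0..t}" for s
        using flow_has_derivative[OF g(1) that] .
      show "\<bar>?w (?y s) - ?w (?y 0)\<bar> \<le> e / 2" if "s \<in> {0..t}" for s
      proof -
        have "dist (?w (?y 0)) (?w p) < e / 4" using t by (intro near) simp
        with near[OF that] show ?thesis unfolding dist_real_def by linarith
      qed
    qed (use t in simp)
    then have "\<bar>u (?y t) - (\<Sum>s\<le>q. t ^ s / fact s * (H g ^^ s) u (y t))\<bar> / t ^ q \<le> e / 2"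
      using t by (simp add: flow_0[OF g(1)] pos_divide_le_eq)
    then have "\<bar>u (?y t) - (\<Sum>s\<le>q. t ^ s / fact s * (H g ^^ s) u (y t))\<bar> / t ^ q < e"
      using e by linarith
    then show ?case using t by (simp add: dist_real_def abs_divide)
  qed
qed

text \<open>Sorts a product of two truncated power series by total degree.\<close>

lemma triangular_sum_by_degree:
  fixes a :: "nat \<Rightarrow> nat \<Rightarrow> real"
  shows "(\<Sum>r\<le>k. \<Sum>s\<le>k - r. a r s) = (\<Sum>q\<le>k. \<Sum>r\<le>q. a r (q - r))"
proof -
  have "(\<Sum>r\<le>k. \<Sum>s\<le>k - r. a r s) = (\<Sum>(r, s)\<in>(SIGMA r:{..k}. {..k - r}). a r s)"
    by (rule sum.Sigma) auto
  also have "(SIGMA r:{..k}. {..k - r}) = {(r, s). r + s \<le> k}" by auto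
  also have "(\<Sum>(r, s)\<in>{(r, s). r + s \<le> k}. a r s) = (\<Sum>q\<le>k. \<Sum>r\<le>q. a r (q - r))"
    by (rule sum.triangle_reindex_eq)
  finally show ?thesis .
qed

text \<open>
  Induction on the list. Put \<open>z t = flow g (y t) t\<close>, which again tends to \<open>p\<close>. The induction hypothesis
  along \<open>z\<close> has coefficients \<open>H_boxplus gs r u (z t)\<close>. Each of them is a function of class \<open>k - r\<close> and is
  itself expanded along the flow of \<open>g\<close>, to order \<open>k - r\<close>, which suffices because it is multiplied by
  \<open>t ^ r\<close>. The resulting double sum is collected by \<open>H_boxplus_Cons\<close>.
\<close>

lemma group_flow_expansion:
  assumes "\<And>g. g \<in> set gs \<Longrightarrow> available F A g" "\<And>g. g \<in> set gs \<Longrightarrow> Ck (k - 1) g"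
    and u: "Ck k u" and "(y \<longlongrightarrow> p) (at_right 0)"
  shows "((\<lambda>t. (u (group_flow gs (y t) t) - (\<Sum>r\<le>k. t ^ r / fact r * H_boxplus gs r u (y t))) / t ^ k)
    \<longlongrightarrow> 0) (at_right 0)"
  using assms(1,2,4)
proof (induction gs arbitrary: y)
  case Nil
  have "(\<Sum>r\<le>k. t ^ r / fact r * (if r = 0 then u (y t) else 0)) = u (y t)" for t :: real
  proof -
    have "(\<Sum>r\<le>k. t ^ r / fact r * (if r = 0 then u (y t) else 0)) =
        (\<Sum>r\<le>k. if r = 0 then u (y t) else 0)"
      by (intro sum.cong) auto
    then show ?thesis by simp
  qed
  then show ?case by (simp add: H_boxplus_Nil)
next
  case (Cons g gs)
  let ?W = "\<lambda>r. H_boxplus gs r u"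
  define z where "z t = flow g (y t) t" for t
  have g: "available F A g" "Ck (k - 1) g" using Cons.prems by auto
  have z: "(z \<longlongrightarrow> p) (at_right 0)"
    unfolding z_def[abs_def] using flow_tendsto[OF g(1) Cons.prems(3)] .
  have E1: "((\<lambda>t. (u (group_flow gs (z t) t) - (\<Sum>r\<le>k. t ^ r / fact r * ?W r (z t))) / t ^ k)
      \<longlongrightarrow> 0) (at_right 0)"
    using Cons.prems z by (intro Cons.IH) auto
  have E2: "((\<lambda>t. (?W r (z t) - (\<Sum>s\<le>k - r. t ^ s / fact s * (H g ^^ s) (?W r) (y t))) / t ^ (k - r))
      \<longlongrightarrow> 0) (at_right 0)" if r: "r \<le> k" for r
    unfolding z_def
  proof (rule flow_expansion[OF g(1) _ _ Cons.prems(3)])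
    show "Ck (k - r - 1) g" using g(2) by (rule Ck_mono) simp
    show "Ck (k - r) (?W r)"
      using Cons.prems(2) r by (intro Ck_H_boxplus[OF _ u]) auto
  qed
  have lim: "((\<lambda>t. (u (group_flow gs (z t) t) - (\<Sum>r\<le>k. t ^ r / fact r * ?W r (z t))) / t ^ k +
      (\<Sum>r\<le>k. 1 / fact r *
        ((?W r (z t) - (\<Sum>s\<le>k - r. t ^ s / fact s * (H g ^^ s) (?W r) (y t))) / t ^ (k - r))))
      \<longlongrightarrow> 0 + (\<Sum>r\<le>k. 1 / fact r * 0)) (at_right 0)" (is "(?E \<longlongrightarrow> _) _")
    by (intro tendsto_add tendsto_sum tendsto_mult tendsto_const E1 E2) simp
  have "(?E \<longlongrightarrow> 0) (at_right 0)"
    using lim by (simp only: mult_zero_right sum.neutral_const add_0_right)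
  then show ?case
  proof (rule Lim_transform_eventually)
    show "eventually (\<lambda>t. (u (group_flow gs (z t) t) - (\<Sum>r\<le>k. t ^ r / fact r * ?W r (z t))) / t ^ k +
      (\<Sum>r\<le>k. 1 / fact r *
        ((?W r (z t) - (\<Sum>s\<le>k - r. t ^ s / fact s * (H g ^^ s) (?W r) (y t))) / t ^ (k - r))) =
      (u (group_flow (g # gs) (y t) t) - (\<Sum>r\<le>k. t ^ r / fact r * H_boxplus (g # gs) r u (y t))) / t ^ k)
      (at_right 0)"
      using eventually_at_right_less[of "0::real"]
    proof eventually_elim
      case (elim t)
      let ?h = "\<lambda>r s. (H g ^^ s) (?W r) (y t)"
      have "(\<Sum>q\<le>k. t ^ q / fact q * H_boxplus (g # gs) q u (y t)) =
          (\<Sum>q\<le>k. t ^ q * (H_boxplus (g # gs) q u (y t) / fact q))"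
        by (intro sum.cong) auto
      also have "\<dots> = (\<Sum>q\<le>k. t ^ q * (\<Sum>r\<le>q. ?h r (q - r) / (fact (q - r) * fact r)))"
        using Cons.prems(2) by (intro sum.cong refl arg_cong2[where f="(*)"] H_boxplus_Cons[OF _ u]) auto
      also have "\<dots> = (\<Sum>q\<le>k. \<Sum>r\<le>q. t ^ (r + (q - r)) * (?h r (q - r) / (fact (q - r) * fact r)))"
        unfolding sum_distrib_left by (intro sum.cong) auto
      also have "\<dots> = (\<Sum>r\<le>k. \<Sum>s\<le>k - r. t ^ (r + s) * (?h r s / (fact s * fact r)))"
        by (rule triangular_sum_by_degree[symmetric])
      also have "\<dots> = (\<Sum>r\<le>k. t ^ r / fact r * (\<Sum>s\<le>k - r. t ^ s / fact s * ?h r s))"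
        unfolding sum_distrib_left by (intro sum.cong refl) (simp add: power_add mult_ac)
      finally have eq: "(\<Sum>q\<le>k. t ^ q / fact q * H_boxplus (g # gs) q u (y t)) =
          (\<Sum>r\<le>k. t ^ r / fact r * (\<Sum>s\<le>k - r. t ^ s / fact s * ?h r s))" .
      have "(\<Sum>r\<le>k. 1 / fact r * ((?W r (z t) - (\<Sum>s\<le>k - r. t ^ s / fact s * ?h r s)) / t ^ (k - r))) =
          (\<Sum>r\<le>k. t ^ r / fact r * (?W r (z t) - (\<Sum>s\<le>k - r. t ^ s / fact s * ?h r s)) / t ^ k)"
      proof (intro sum.cong refl)
        fix r assume "r \<in> {..k}"
        then have "t ^ k = t ^ r * t ^ (k - r)" by (simp add: power_add[symmetric])
        then show "1 / fact r * ((?W r (z t) - (\<Sum>s\<le>k - r. t ^ s / fact s * ?h r s)) / t ^ (k - r)) =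
          t ^ r / fact r * (?W r (z t) - (\<Sum>s\<le>k - r. t ^ s / fact s * ?h r s)) / t ^ k"
          using elim by simp
      qed
      also have "\<dots> = ((\<Sum>r\<le>k. t ^ r / fact r * ?W r (z t)) -
          (\<Sum>r\<le>k. t ^ r / fact r * (\<Sum>s\<le>k - r. t ^ s / fact s * ?h r s))) / t ^ k"
        by (simp only: sum_divide_distrib[symmetric] right_diff_distrib sum_subtractf)
      finally show ?case
        unfolding eq group_flow.simps z_def[symmetric] by (simp add: diff_divide_distrib)
    qed
  qed
qed

text \<open>
  Apply the expansion to the coordinate functions with the constant path: the term of order 0 is the
  starting point, those of order below \<open>k\<close> vanish.
\<close>

lemma group_flow_leading_term:
  assumes "\<And>g. g \<in> set gs \<Longrightarrow> available F A g" "\<And>g. g \<in> set gs \<Longrightarrow> Ck (k - 1) g"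
    and k: "0 < k"
    and vanish: "\<And>r. 1 \<le> r \<Longrightarrow> r < k \<Longrightarrow> H_boxplus_vec gs r id p = 0"
    and v: "v = (1 / fact k) *\<^sub>R H_boxplus_vec gs k id p"
  shows "((\<lambda>t. (1 / t ^ k) *\<^sub>R (group_flow gs p t - p) - v) \<longlongrightarrow> 0) (at_right 0)"
proof (rule vec_tendstoI)
  fix l
  have vec: "H_boxplus_vec gs r id p $ l = H_boxplus gs r (\<lambda>z. z $ l) p" for r
    by (simp add: H_boxplus_vec_def)
  have "((\<lambda>t. (group_flow gs p t $ l - (\<Sum>r\<le>k. t ^ r / fact r * H_boxplus gs r (\<lambda>z. z $ l) p)) / t ^ k)
      \<longlongrightarrow> 0) (at_right 0)"
    using assms by (intro group_flow_expansion Ck_nth Ck_ident tendsto_const) auto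
  moreover have "(\<Sum>r\<le>k. t ^ r / fact r * H_boxplus gs r (\<lambda>z. z $ l) p) = p $ l + t ^ k * v $ l" for t :: real
  proof -
    have "(\<Sum>r\<le>k. t ^ r / fact r * H_boxplus gs r (\<lambda>z. z $ l) p) =
        (\<Sum>r\<in>{0, k}. t ^ r / fact r * H_boxplus gs r (\<lambda>z. z $ l) p)"
    proof (rule sum.mono_neutral_right)
      show "\<forall>r\<in>{..k} - {0, k}. t ^ r / fact r * H_boxplus gs r (\<lambda>z. z $ l) p = 0"
        using vanish by (auto simp: vec[symmetric])
    qed auto
    moreover have "v $ l = H_boxplus gs k (\<lambda>z. z $ l) p / fact k" by (simp add: v vec)
    ultimately show ?thesis using k by (simp add: H_boxplus_0)
  qed
  ultimately have lim: "((\<lambda>t. (group_flow gs p t $ l - (p $ l + t ^ k * v $ l)) / t ^ k) \<longlongrightarrow> 0) (at_right 0)"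
    by simp
  show "((\<lambda>t. ((1 / t ^ k) *\<^sub>R (group_flow gs p t - p) - v) $ l) \<longlongrightarrow> 0 $ l) (at_right 0)"
    unfolding zero_index
  proof (rule Lim_transform_eventually[OF lim])
    show "eventually (\<lambda>t. (group_flow gs p t $ l - (p $ l + t ^ k * v $ l)) / t ^ k =
        ((1 / t ^ k) *\<^sub>R (group_flow gs p t - p) - v) $ l) (at_right 0)"
      using eventually_at_right_less[of "0::real"]
      by eventually_elim (simp add: field_simps)
  qed
qed

text \<open>
  Compare the displacement from \<open>x\<close> with that from \<open>p\<close>, and the latter with its leading term. The
  constant \<open>K\<close> is independent of \<open>e\<close>, as needed below, where \<open>e\<close> and then the radius are chosen small.
\<close>

lemma group_flow_step:
  assumes gs: "\<And>g. g \<in> set gs \<Longrightarrow> available F A g" "\<And>g. g \<in> set gs \<Longrightarrow> Ck (k - 1) g"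
    and k: "0 < k"
    and vanish: "\<And>r. 1 \<le> r \<Longrightarrow> r < k \<Longrightarrow> H_boxplus_vec gs r id p = 0"
    and v: "v = (1 / fact k) *\<^sub>R H_boxplus_vec gs k id p"
  shows "\<exists>K>0. \<forall>e>0. \<exists>d>0. \<forall>t x. 0 \<le> t \<longrightarrow> t \<le> d \<longrightarrow> norm (x - p) \<le> d \<longrightarrow>
    norm (group_flow gs x t - x - t ^ k *\<^sub>R v) \<le> e * t ^ k + K * t * norm (x - p)"
proof -
  obtain K r where K: "K > 0" and r: "r > 0" and lip:
    "\<And>t x y. 0 \<le> t \<Longrightarrow> t \<le> r \<Longrightarrow> x \<in> cball p r \<Longrightarrow> y \<in> cball p r \<Longrightarrow>
       norm ((group_flow gs x t - x) - (group_flow gs y t - y)) \<le> K * t * norm (x - y)"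
    using group_flow_displacement_lipschitz[OF gs(1)] by blast
  have "\<exists>d>0. \<forall>t x. 0 \<le> t \<longrightarrow> t \<le> d \<longrightarrow> norm (x - p) \<le> d \<longrightarrow>
    norm (group_flow gs x t - x - t ^ k *\<^sub>R v) \<le> e * t ^ k + K * t * norm (x - p)" if e: "e > 0" for e
  proof -
    have "eventually (\<lambda>t. dist ((1 / t ^ k) *\<^sub>R (group_flow gs p t - p) - v) 0 < e) (at_right 0)"
      using group_flow_leading_term[OF assms] e by (rule tendstoD)
    then obtain b where b: "b > 0" and lead:
      "\<And>t. 0 < t \<Longrightarrow> t < b \<Longrightarrow> norm ((1 / t ^ k) *\<^sub>R (group_flow gs p t - p) - v) < e"
      by (auto simp: eventually_at_right_field)
    have lead': "norm (group_flow gs p t - p - t ^ k *\<^sub>R v) \<le> e * t ^ k" if t: "0 \<le> t" "t < b" for t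
    proof (cases "t = 0")
      case True
      then show ?thesis using k by (simp add: group_flow_0[OF gs(1)] zero_power)
    next
      case False
      have "group_flow gs p t - p - t ^ k *\<^sub>R v = t ^ k *\<^sub>R ((1 / t ^ k) *\<^sub>R (group_flow gs p t - p) - v)"
        using False by (simp add: scaleR_diff_right)
      then have "norm (group_flow gs p t - p - t ^ k *\<^sub>R v) =
          t ^ k * norm ((1 / t ^ k) *\<^sub>R (group_flow gs p t - p) - v)"
        using t by simp
      also have "\<dots> \<le> t ^ k * e"
        using lead[of t] t False by (intro mult_left_mono) auto
      finally show ?thesis by (simp add: mult.commute)
    qed
    show ?thesis
    proof (intro exI[of _ "min r (b / 2)"] conjI allI impI)
      show "0 < min r (b / 2)" using r b by simp
      fix t x assume t: "0 \<le> t" "t \<le> min r (b / 2)" and x: "norm (x - p) \<le> min r (b / 2)"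
      have "norm ((group_flow gs x t - x) - (group_flow gs p t - p)) \<le> K * t * norm (x - p)"
        using t x r by (intro lip) (auto simp: dist_norm norm_minus_commute)
      moreover have "norm (group_flow gs p t - p - t ^ k *\<^sub>R v) \<le> e * t ^ k"
        using t b by (intro lead') auto
      moreover have "norm (group_flow gs x t - x - t ^ k *\<^sub>R v) \<le>
          norm ((group_flow gs x t - x) - (group_flow gs p t - p)) +
          norm (group_flow gs p t - p - t ^ k *\<^sub>R v)"
        by (rule order_trans[OF eq_refl norm_triangle_ineq], rule arg_cong[where f=norm]) simp
      ultimately show "norm (group_flow gs x t - x - t ^ k *\<^sub>R v) \<le> e * t ^ k + K * t * norm (x - p)"
        by linarith
    qed
  qed
  then show ?thesis using K by blast
qed

end

section \<open>Steering to the target\<close>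

lemma root_eq_powr: "0 < n \<Longrightarrow> 0 \<le> x \<Longrightarrow> root n x = x powr (1 / real n)"
  by (cases "x = 0") (auto simp: root_powr_inverse)

text \<open>
  Decompose \<open>x\<close> along the standard basis vectors with suitable signs and combine fixed representations of
  the finitely many vectors \<open>b\<close> and \<open>- b\<close>; the coefficients then grow at most linearly in \<open>x\<close>.
\<close>

lemma positive_basis_bounded_coefficients:
  fixes v :: "nat \<Rightarrow> 'a::euclidean_space"
  assumes "positive_basis m v"
  shows "\<exists>B>0. \<forall>x. \<exists>c. (\<forall>i\<in>{1..m}. 0 \<le> c i \<and> c i \<le> B * norm x) \<and> x = (\<Sum>i=1..m. c i *\<^sub>R v i)"
proof -
  have "\<forall>x. \<exists>c. (\<forall>i\<in>{1..m}. 0 \<le> c i) \<and> x = (\<Sum>i=1..m. c i *\<^sub>R v i)"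
    using assms by (simp add: positive_basis_def)
  from choice[OF this] obtain c
    where c': "\<forall>x. (\<forall>i\<in>{1..m}. 0 \<le> c x i) \<and> x = (\<Sum>i=1..m. c x i *\<^sub>R v i)" by (rule exE)
  have c: "0 \<le> c x i" if "i \<in> {1..m}" for x i
    using bspec[OF conjunct1[OF spec[OF c']] that] .
  have c_sum: "x = (\<Sum>i=1..m. c x i *\<^sub>R v i)" for x
    by (rule conjunct2[OF spec[OF c']])
  define B where "B = 1 + (\<Sum>b\<in>Basis. \<Sum>i=1..m. c b i + c (- b) i)"
  have B: "B > 0" unfolding B_def
    by (intro add_pos_nonneg sum_nonneg add_nonneg_nonneg c) auto
  show ?thesis
  proof (rule exI[of _ B], rule conjI[OF B], rule allI)
    fix x :: 'a
    define s where "s b = (if 0 \<le> x \<bullet> b then b else - b)" for b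
    define d where "d i = (\<Sum>b\<in>Basis. \<bar>x \<bullet> b\<bar> * c (s b) i)" for i
    have "0 \<le> d i \<and> d i \<le> B * norm x" if i: "i \<in> {1..m}" for i
    proof
      show "0 \<le> d i" unfolding d_def by (intro sum_nonneg mult_nonneg_nonneg c i) simp
      have "d i \<le> (\<Sum>b\<in>Basis. norm x * (\<Sum>i=1..m. c b i + c (- b) i))"
        unfolding d_def
      proof (intro sum_mono mult_mono)
        fix b :: 'a assume "b \<in> Basis"
        then show "\<bar>x \<bullet> b\<bar> \<le> norm x" by (rule Basis_le_norm)
        have "c (s b) i \<le> c b i + c (- b) i" using c[OF i, of b] c[OF i, of "- b"] by (simp add: s_def)
        also have "\<dots> \<le> (\<Sum>i=1..m. c b i + c (- b) i)"
        proof (rule member_le_sum[OF i, of "\<lambda>i. c b i + c (- b) i"])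
          show "0 \<le> c b j + c (- b) j" if "j \<in> {1..m} - {i}" for j
            using that by (intro add_nonneg_nonneg c) auto
        qed simp
        finally show "c (s b) i \<le> (\<Sum>i=1..m. c b i + c (- b) i)" .
      qed (use c[OF i] in auto)
      also have "\<dots> \<le> B * norm x" by (simp add: B_def sum_distrib_left[symmetric] algebra_simps)
      finally show "d i \<le> B * norm x" .
    qed
    moreover have "x = (\<Sum>i=1..m. d i *\<^sub>R v i)"
    proof -
      have "(\<Sum>i=1..m. d i *\<^sub>R v i) = (\<Sum>b\<in>Basis. \<Sum>i=1..m. \<bar>x \<bullet> b\<bar> *\<^sub>R (c (s b) i *\<^sub>R v i))"
        unfolding d_def scaleR_sum_left by (subst sum.swap) simp
      also have "\<dots> = (\<Sum>b\<in>Basis. \<bar>x \<bullet> b\<bar> *\<^sub>R s b)"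
        by (simp only: scaleR_sum_right[symmetric] c_sum[symmetric])
      also have "\<dots> = (\<Sum>b\<in>Basis. (x \<bullet> b) *\<^sub>R b)"
        by (intro sum.cong) (auto simp: s_def)
      finally show ?thesis by (simp add: euclidean_representation)
    qed
    ultimately show "\<exists>c. (\<forall>i\<in>{1..m}. 0 \<le> c i \<and> c i \<le> B * norm x) \<and> x = (\<Sum>i=1..m. c i *\<^sub>R v i)"
      by blast
  qed
qed

lemma uniform_radius:
  fixes P :: "'a \<Rightarrow> real \<Rightarrow> bool"
  assumes "finite I" "\<And>i. i \<in> I \<Longrightarrow> \<exists>d>0. P i d"
    and mono: "\<And>i d d'. P i d \<Longrightarrow> 0 < d' \<Longrightarrow> d' \<le> d \<Longrightarrow> P i d'"
  shows "\<exists>d>0. \<forall>i\<in>I. P i d"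
  using assms(1,2)
proof (induction I rule: finite_induct)
  case empty
  show ?case by (rule exI[of _ 1]) simp
next
  case (insert j I)
  have "\<exists>d>0. \<forall>i\<in>I. P i d" by (rule insert.IH) (rule insert.prems, simp)
  then obtain d where d: "d > 0" "\<forall>i\<in>I. P i d" by blast
  have "\<exists>e>0. P j e" by (rule insert.prems) simp
  then obtain e where e: "e > 0" "P j e" by blast
  have "P j (min d e)" by (rule mono[OF e(2)]) (use d(1) e(1) in simp_all)
  moreover have "P i (min d e)" if "i \<in> I" for i
    by (rule mono[OF bspec[OF d(2) that]]) (use d(1) e(1) in simp_all)
  moreover have "0 < min d e" using d(1) e(1) by simp
  ultimately show ?case by blast
qed

context well_posed_system
begin

text \<open>
  Let \<open>\<rho> = norm (x - p)\<close> and \<open>p - x = (\<Sum>i=1..m. c i *\<^sub>R v i)\<close> with \<open>0 \<le> c i \<le> B * \<rho>\<close>. The time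
  \<open>t i = root (k i) (c i)\<close> is chosen so that the leading term of step \<open>i\<close> is exactly \<open>c i *\<^sub>R v i\<close>, and
  \<open>B * \<rho> \<le> 1\<close> ensures \<open>t i \<le> h = root kb (B * \<rho>)\<close>. The intermediate points stay within
  \<open>G ^ m * \<rho>\<close> of \<open>p\<close>, so the total error is at most \<open>m * (e * B + K' * h * G ^ m) * \<rho>\<close>. Here \<open>e\<close> makes
  the first summand at most a quarter, and a small radius, through \<open>h \<le> b\<close>, the second.
\<close>

lemma contraction_step:
  fixes \<Psi> :: "nat \<Rightarrow> real ^ 'n \<Rightarrow> real \<Rightarrow> real ^ 'n"
  assumes nonempty: "A \<noteq> {}"
    and reach: "\<And>i x t. i \<in> {1..m} \<Longrightarrow> 0 \<le> t \<Longrightarrow> reaches F A (N i * t) x (\<Psi> i x t)"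
    and N: "\<And>i. i \<in> {1..m} \<Longrightarrow> 0 \<le> N i"
    and step: "\<And>i. i \<in> {1..m} \<Longrightarrow> \<exists>K>0. \<forall>e>0. \<exists>d>0. \<forall>t x. 0 \<le> t \<longrightarrow> t \<le> d \<longrightarrow> norm (x - p) \<le> d \<longrightarrow>
      norm (\<Psi> i x t - x - t ^ k i *\<^sub>R v i) \<le> e * t ^ k i + K * t * norm (x - p)"
    and k: "\<And>i. i \<in> {1..m} \<Longrightarrow> 0 < k i \<and> k i \<le> kb" and kb: "0 < kb"
    and basis: "positive_basis m v"
  shows "\<exists>C\<ge>0. \<exists>r>0. \<forall>x\<in>cball p r. \<exists>\<tau> z. reaches F A \<tau> x z \<and>
    norm (z - p) \<le> norm (x - p) / 2 \<and> \<tau> \<le> C * root kb (norm (x - p))"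
proof -
  obtain B where B: "B > 0" and coeffs:
    "\<And>x. \<exists>c. (\<forall>i\<in>{1..m}. 0 \<le> c i \<and> c i \<le> B * norm x) \<and> x = (\<Sum>i=1..m. c i *\<^sub>R v i)"
    using positive_basis_bounded_coefficients[OF basis] by blast
  define V where "V = (\<Sum>i=1..m. norm (v i))"
  have V: "norm (v i) \<le> V" if "i \<in> {1..m}" for i
    unfolding V_def by (rule member_le_sum[OF that]) auto
  have V0: "0 \<le> V" unfolding V_def by (intro sum_nonneg) simp
  define G where "G = 2 + (V + 1) * B"
  have G: "G \<ge> 1" using V0 B by (simp add: G_def add_increasing2)
  define e where "e = 1 / (4 * (real m + 1) * (B + 1))"
  have e: "e > 0" using B by (simp add: e_def)
  have e1: "e \<le> 1"
  proof -
    have "1 * 1 \<le> (4 * (real m + 1)) * (B + 1)" using B by (intro mult_mono) auto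
    then show ?thesis using B by (simp add: e_def)
  qed
  have emB: "real m * (e * B) \<le> 1 / 4"
  proof -
    have "real m * B \<le> (real m + 1) * (B + 1)" using B by (intro mult_mono) auto
    moreover have "0 < (real m + 1) * (B + 1)" using B by simp
    ultimately have "real m * B / ((real m + 1) * (B + 1)) \<le> 1" by (simp only: divide_le_eq_1_pos)
    then have "real m * B / ((real m + 1) * (B + 1)) / 4 \<le> 1 / 4" by (rule divide_right_mono) simp
    then show ?thesis by (simp add: e_def mult_ac)
  qed
  define K where "K i = (SOME K. K > 0 \<and> (\<forall>e>0. \<exists>d>0. \<forall>t x. 0 \<le> t \<longrightarrow> t \<le> d \<longrightarrow> norm (x - p) \<le> d \<longrightarrow>
      norm (\<Psi> i x t - x - t ^ k i *\<^sub>R v i) \<le> e * t ^ k i + K * t * norm (x - p)))" for i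
  have K: "K i > 0 \<and> (\<forall>e>0. \<exists>d>0. \<forall>t x. 0 \<le> t \<longrightarrow> t \<le> d \<longrightarrow> norm (x - p) \<le> d \<longrightarrow>
      norm (\<Psi> i x t - x - t ^ k i *\<^sub>R v i) \<le> e * t ^ k i + K i * t * norm (x - p))"
    if "i \<in> {1..m}" for i
    unfolding K_def using step[OF that] by (rule someI_ex)
  have K_pos: "0 < K i" if "i \<in> {1..m}" for i using K[OF that] by (rule conjunct1)
  define K' where "K' = 1 + (\<Sum>i=1..m. K i)"
  have KK': "K i \<le> K'" if i: "i \<in> {1..m}" for i
  proof -
    have "K i \<le> (\<Sum>i=1..m. K i)"
      by (rule member_le_sum[OF i]) (use K_pos in \<open>auto intro: less_imp_le\<close>)
    then show ?thesis by (simp add: K'_def)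
  qed
  have K': "K' > 0" unfolding K'_def
    by (intro add_pos_nonneg sum_nonneg) (use K_pos in \<open>auto intro: less_imp_le\<close>)
  have "\<exists>d>0. \<forall>i\<in>{1..m}. \<forall>t x. 0 \<le> t \<longrightarrow> t \<le> d \<longrightarrow> norm (x - p) \<le> d \<longrightarrow>
      norm (\<Psi> i x t - x - t ^ k i *\<^sub>R v i) \<le> e * t ^ k i + K i * t * norm (x - p)"
  proof (rule uniform_radius)
    show "\<exists>d>0. \<forall>t x. 0 \<le> t \<longrightarrow> t \<le> d \<longrightarrow> norm (x - p) \<le> d \<longrightarrow>
      norm (\<Psi> i x t - x - t ^ k i *\<^sub>R v i) \<le> e * t ^ k i + K i * t * norm (x - p)"
      if "i \<in> {1..m}" for i using K[OF that] e by blast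
  qed auto
  then obtain d where d: "d > 0" and est: "\<And>i t x. i \<in> {1..m} \<Longrightarrow> 0 \<le> t \<Longrightarrow> t \<le> d \<Longrightarrow> norm (x - p) \<le> d \<Longrightarrow>
      norm (\<Psi> i x t - x - t ^ k i *\<^sub>R v i) \<le> e * t ^ k i + K i * t * norm (x - p)"
    by blast
  define b where "b = min d (1 / (4 * (real m + 1) * K' * G ^ m))"
  have Gm: "G ^ m \<ge> 1" using G by (rule one_le_power)
  have b: "b > 0" using d K' Gm by (simp add: b_def)
  have bK: "real m * (K' * b * G ^ m) \<le> 1 / 4" and bK1: "K' * b \<le> 1"
  proof -
    have "b \<le> 1 / (4 * (real m + 1) * K' * G ^ m)" by (simp add: b_def)
    moreover have "0 < 4 * (real m + 1) * K' * G ^ m" using K' Gm by simp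
    ultimately have "b * (4 * (real m + 1) * K' * G ^ m) \<le> 1" by (simp only: pos_le_divide_eq)
    then have *: "4 * (real m + 1) * (K' * b * G ^ m) \<le> 1" by (simp only: mult_ac)
    moreover have pos: "0 \<le> K' * b * G ^ m" using K' b Gm by simp
    ultimately show "real m * (K' * b * G ^ m) \<le> 1 / 4" by (simp add: algebra_simps)
    have "K' * b * 1 \<le> K' * b * G ^ m" using K' b Gm by (intro mult_left_mono) auto
    moreover have "1 * (K' * b * G ^ m) \<le> 4 * (real m + 1) * (K' * b * G ^ m)"
      using pos by (intro mult_right_mono) auto
    ultimately show "K' * b \<le> 1" using * by linarith
  qed
  define r where "r = min (1 / B) (min (b ^ kb / B) (d / G ^ m))"
  have r: "r > 0" using B b d Gm by (simp add: r_def)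
  define C where "C = (\<Sum>i=1..m. N i) * root kb B"
  have C: "C \<ge> 0" unfolding C_def using N B by (intro mult_nonneg_nonneg sum_nonneg real_root_ge_zero) auto
  show ?thesis
  proof (rule exI[of _ C], rule conjI[OF C], rule exI[of _ r], rule conjI[OF r], rule ballI)
    fix x assume "x \<in> cball p r"
    define \<rho> where "\<rho> = norm (x - p)"
    have \<rho>: "0 \<le> \<rho>" "\<rho> \<le> r" using \<open>x \<in> cball p r\<close> by (auto simp: \<rho>_def dist_norm norm_minus_commute)
    have "\<rho> \<le> 1 / B" "\<rho> \<le> b ^ kb / B" "\<rho> \<le> d / G ^ m" using \<rho>(2) by (auto simp: r_def)
    then have B\<rho>: "B * \<rho> \<le> 1" "B * \<rho> \<le> b ^ kb" and G\<rho>: "G ^ m * \<rho> \<le> d"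
      using B Gm by (simp_all add: field_simps)
    define h where "h = root kb (B * \<rho>)"
    have "h \<le> root kb (b ^ kb)" unfolding h_def using B\<rho>(2) kb by simp
    then have hb: "h \<le> b" using b kb by (simp add: real_root_power_cancel)
    have h0: "0 \<le> h" unfolding h_def using B \<rho> by (simp add: real_root_ge_zero)
    have hd: "h \<le> d" using hb by (simp add: b_def)
    obtain c where c: "\<And>i. i \<in> {1..m} \<Longrightarrow> 0 \<le> c i \<and> c i \<le> B * \<rho>"
      and c_sum: "p - x = (\<Sum>i=1..m. c i *\<^sub>R v i)"
      using coeffs[of "p - x"] unfolding \<rho>_def norm_minus_commute[of p x] by blast
    define t where "t i = root (k i) (c i)" for i
    have t: "0 \<le> t i" "t i ^ k i = c i" "t i \<le> h" if i: "i \<in> {1..m}" for i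
    proof -
      show "0 \<le> t i" "t i ^ k i = c i" using c[OF i] k[OF i] by (auto simp: t_def)
      have "t i \<le> root (k i) (B * \<rho>)" using c[OF i] k[OF i] by (simp add: t_def)
      also have "\<dots> \<le> h"
      proof (cases "k i = kb")
        case False
        then show ?thesis unfolding h_def using k[OF i] B \<rho> B\<rho>(1) by (intro real_root_increasing) auto
      qed (simp add: h_def)
      finally show "t i \<le> h" .
    qed
    define q where "q = rec_nat x (\<lambda>i y. \<Psi> (Suc i) y (t (Suc i)))"
    have q: "q 0 = x" "q (Suc i) = \<Psi> (Suc i) (q i) (t (Suc i))" for i
      by (simp_all add: q_def)
    have q_est: "norm (q (Suc i) - q i - c (Suc i) *\<^sub>R v (Suc i)) \<le> e * (B * \<rho>) + K' * h * norm (q i - p)"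
      if i: "Suc i \<in> {1..m}" and qi: "norm (q i - p) \<le> d" for i
    proof -
      have "norm (q (Suc i) - q i - c (Suc i) *\<^sub>R v (Suc i)) \<le>
          e * c (Suc i) + K (Suc i) * t (Suc i) * norm (q i - p)"
        using est[OF i t(1)[OF i] order_trans[OF t(3)[OF i] hd] qi] by (simp add: q t(2)[OF i])
      also have "\<dots> \<le> e * (B * \<rho>) + K' * h * norm (q i - p)"
        using c[OF i] e KK'[OF i] K' t(1,3)[OF i]
        by (intro add_mono mult_left_mono mult_right_mono mult_mono) auto
      finally show ?thesis .
    qed
    have grow: "norm (q i - p) \<le> G ^ i * \<rho>" if "i \<le> m" for i
      using that
    proof (induction i)
      case 0
      show ?case by (simp add: q \<rho>_def)
    next
      case (Suc i)
      have i: "Suc i \<in> {1..m}" using Suc.prems by simp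
      have IH: "norm (q i - p) \<le> G ^ i * \<rho>" using Suc by simp
      have "G ^ i \<le> G ^ m" using Suc.prems G by (intro power_increasing) auto
      then have "G ^ i * \<rho> \<le> d" using G\<rho> mult_right_mono[OF _ \<rho>(1), of "G ^ i" "G ^ m"] by linarith
      then have qd: "norm (q i - p) \<le> d" using IH by linarith
      have "norm (q (Suc i) - p) \<le> norm (q i - p) + norm (c (Suc i) *\<^sub>R v (Suc i)) +
          norm (q (Suc i) - q i - c (Suc i) *\<^sub>R v (Suc i))"
        using norm_triangle_ineq[of "q i - p" "c (Suc i) *\<^sub>R v (Suc i)"]
          norm_triangle_ineq[of "q i - p + c (Suc i) *\<^sub>R v (Suc i)" "q (Suc i) - q i - c (Suc i) *\<^sub>R v (Suc i)"]
        by simp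
      also have "\<dots> \<le> norm (q i - p) + (B * \<rho>) * V + (1 * (B * \<rho>) + 1 * norm (q i - p))"
      proof (intro add_mono order_trans[OF q_est[OF i qd]] mult_right_mono)
        show "norm (c (Suc i) *\<^sub>R v (Suc i)) \<le> (B * \<rho>) * V"
          unfolding norm_scaleR using c[OF i] V[OF i] by (intro mult_mono) auto
        have "K' * h \<le> K' * b" using hb K' by (intro mult_left_mono) auto
        then show "K' * h \<le> 1" using bK1 by linarith
      qed (use e1 B \<rho> in auto)
      also have "\<dots> = 2 * norm (q i - p) + (V + 1) * B * \<rho>" by (simp add: algebra_simps)
      also have "\<dots> \<le> 2 * (G ^ i * \<rho>) + (V + 1) * B * (G ^ i * \<rho>)"
      proof (intro add_mono mult_left_mono IH)
        have "1 * \<rho> \<le> G ^ i * \<rho>" using G \<rho> by (intro mult_right_mono one_le_power) auto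
        then show "\<rho> \<le> G ^ i * \<rho>" by simp
      qed (use V0 B in auto)
      also have "\<dots> = G ^ Suc i * \<rho>" by (simp add: G_def algebra_simps)
      finally show ?case .
    qed
    have err: "norm (q i - x - (\<Sum>j=1..i. c j *\<^sub>R v j)) \<le> real i * (e * (B * \<rho>) + K' * b * (G ^ m * \<rho>))"
      if "i \<le> m" for i
      using that
    proof (induction i)
      case 0
      show ?case by (simp add: q)
    next
      case (Suc i)
      have i: "Suc i \<in> {1..m}" using Suc.prems by simp
      have "G ^ i \<le> G ^ m" using Suc.prems G by (intro power_increasing) auto
      then have Gi: "G ^ i * \<rho> \<le> G ^ m * \<rho>" using \<rho>(1) by (rule mult_right_mono)
      then have qG: "norm (q i - p) \<le> G ^ m * \<rho>" using grow[of i] Suc.prems by linarith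
      have "norm (q (Suc i) - q i - c (Suc i) *\<^sub>R v (Suc i)) \<le> e * (B * \<rho>) + K' * h * norm (q i - p)"
        using qG G\<rho> by (intro q_est[OF i]) linarith
      also have "\<dots> \<le> e * (B * \<rho>) + K' * b * (G ^ m * \<rho>)"
        using qG hb h0 K' b by (intro add_mono order_refl mult_mono) auto
      finally have new: "norm (q (Suc i) - q i - c (Suc i) *\<^sub>R v (Suc i)) \<le>
          e * (B * \<rho>) + K' * b * (G ^ m * \<rho>)" .
      have "norm (q (Suc i) - x - (\<Sum>j=1..Suc i. c j *\<^sub>R v j)) \<le>
          norm (q i - x - (\<Sum>j=1..i. c j *\<^sub>R v j)) + norm (q (Suc i) - q i - c (Suc i) *\<^sub>R v (Suc i))"
        by (rule order_trans[OF eq_refl norm_triangle_ineq], rule arg_cong[where f=norm]) simp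
      also have "\<dots> \<le> real i * (e * (B * \<rho>) + K' * b * (G ^ m * \<rho>)) +
          (e * (B * \<rho>) + K' * b * (G ^ m * \<rho>))"
        using Suc new by (intro add_mono) auto
      finally show ?case by (simp add: algebra_simps)
    qed
    have "q m - p = q m - x - (\<Sum>j=1..m. c j *\<^sub>R v j)" unfolding c_sum[symmetric] by simp
    then have "norm (q m - p) \<le> real m * (e * (B * \<rho>) + K' * b * (G ^ m * \<rho>))"
      using err[OF order_refl] by (simp only:)
    also have "\<dots> = (real m * (e * B) + real m * (K' * b * G ^ m)) * \<rho>" by (simp add: algebra_simps)
    also have "\<dots> \<le> (1 / 4 + 1 / 4) * \<rho>" using emB bK \<rho> by (intro mult_right_mono add_mono) auto
    finally have half: "norm (q m - p) \<le> \<rho> / 2" by simp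
    have reach_q: "reaches F A (\<Sum>j=1..i. N j * t j) x (q i)" if "i \<le> m" for i
      using that
    proof (induction i)
      case 0
      show ?case using reaches_refl[OF nonempty] by (simp add: q)
    next
      case (Suc i)
      have "reaches F A ((\<Sum>j=1..i. N j * t j) + N (Suc i) * t (Suc i)) x (q (Suc i))"
        unfolding q(2) using Suc t(1)[of "Suc i"]
        by (intro reaches_trans[OF Suc.IH reach]) auto
      then show ?case by simp
    qed
    have "(\<Sum>j=1..m. N j * t j) \<le> (\<Sum>j=1..m. N j * h)"
      using t(3) N by (intro sum_mono mult_left_mono) auto
    also have "\<dots> = C * root kb \<rho>"
      by (simp add: sum_distrib_right[symmetric] C_def h_def real_root_mult mult.assoc)
    finally have "(\<Sum>j=1..m. N j * t j) \<le> C * root kb \<rho>" .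
    with half reach_q[of m] show "\<exists>\<tau> z. reaches F A \<tau> x z \<and>
        norm (z - p) \<le> norm (x - p) / 2 \<and> \<tau> \<le> C * root kb (norm (x - p))"
      unfolding \<rho>_def[symmetric] by blast
  qed
qed

text \<open>
  The \<open>n\<close>-th step starts within \<open>norm (x - p) / 2 ^ n\<close> of \<open>p\<close>, so its duration is at most
  \<open>C * root kb (norm (x - p))\<close> times the \<open>n\<close>-th power of \<open>root kb (1 / 2)\<close>, which is below 1.
\<close>

lemma attainable_from_contraction:
  assumes kb: "0 < kb" and C: "0 \<le> C" and r: "0 < r"
    and step: "\<forall>x\<in>cball p r. \<exists>\<tau> z. reaches F A \<tau> x z \<and>
      norm (z - p) \<le> norm (x - p) / 2 \<and> \<tau> \<le> C * root kb (norm (x - p))"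
    and x: "x \<in> cball p r"
  shows "\<exists>\<tau>. reaches F A \<tau> x p \<and> \<tau> \<le> C / (1 - root kb (1 / 2)) * root kb (norm (x - p))"
proof -
  obtain T where "\<forall>x\<in>cball p r. \<exists>z. reaches F A (T x) x z \<and>
      norm (z - p) \<le> norm (x - p) / 2 \<and> T x \<le> C * root kb (norm (x - p))"
    using bchoice[OF step] by blast
  from bchoice[OF this] obtain Z where TZ: "\<forall>x\<in>cball p r. reaches F A (T x) x (Z x) \<and>
      norm (Z x - p) \<le> norm (x - p) / 2 \<and> T x \<le> C * root kb (norm (x - p))"
    by blast
  define X where "X n = (Z ^^ n) x" for n
  have X: "X 0 = x" "X (Suc n) = Z (X n)" for n by (simp_all add: X_def)
  have close: "X n \<in> cball p r \<and> norm (X n - p) \<le> norm (x - p) * (1 / 2) ^ n" for n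
  proof (induction n)
    case 0
    show ?case using x by (simp add: X)
  next
    case (Suc n)
    then have h: "norm (X (Suc n) - p) \<le> norm (X n - p) / 2" using TZ by (simp add: X)
    moreover have "norm (X n - p) \<le> r" using Suc by (simp add: dist_norm norm_minus_commute)
    ultimately have "norm (X (Suc n) - p) \<le> r" using norm_ge_zero[of "X n - p"] by linarith
    then show ?case using h Suc by (simp add: dist_norm norm_minus_commute)
  qed
  define s where "s = root kb (1 / 2 :: real)"
  have s: "0 \<le> s" "s < 1" using kb by (auto simp: s_def real_root_ge_zero)
  define D where "D = C * root kb (norm (x - p))"
  have tau: "T (X n) \<le> D * s ^ n" for n
  proof -
    have "T (X n) \<le> C * root kb (norm (X n - p))" using TZ close[of n] by blast
    also have "\<dots> \<le> C * root kb (norm (x - p) * (1 / 2) ^ n)"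
      using close[of n] C kb by (intro mult_left_mono) auto
    also have "\<dots> = D * s ^ n"
      using kb by (simp add: D_def s_def real_root_mult real_root_power)
    finally show ?thesis .
  qed
  have reach: "reaches F A (T (X n)) (X n) (X (Suc n))" for n
    unfolding X(2) using TZ close[of n] by blast
  then have T0: "0 \<le> T (X n)" for n by (simp add: reaches_def)
  have geo: "summable (\<lambda>n. D * s ^ n)" using s by (intro summable_mult summable_geometric) simp
  have sm: "summable (\<lambda>n. T (X n))"
    by (rule summable_comparison_test[OF _ geo]) (use tau T0 in auto)
  have "X \<longlonglongrightarrow> p"
  proof (rule Lim_null[THEN iffD2], rule Lim_null_comparison)
    show "eventually (\<lambda>n. norm (X n - p) \<le> norm (x - p) * (1 / 2) ^ n) sequentially"
      using close by simp
    show "(\<lambda>n. norm (x - p) * (1 / 2) ^ n) \<longlonglongrightarrow> 0"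
      by (intro tendsto_mult_right_zero LIMSEQ_power_zero) simp
  qed
  from reaches_limit[OF reach sm this]
  have "reaches F A (\<Sum>n. T (X n)) x p" by (simp add: X)
  moreover have "(\<Sum>n. T (X n)) \<le> (\<Sum>n. D * s ^ n)"
    using tau sm geo by (rule suminf_le)
  moreover have "(\<Sum>n. D * s ^ n) = D * (1 / (1 - s))"
    using s by (simp add: suminf_mult suminf_geometric summable_geometric)
  ultimately show ?thesis unfolding s_def D_def by (intro exI[of _ "\<Sum>n. T (X n)"]) (simp add: mult_ac)
qed

text \<open>
  A control for \<open>x\<close> is applied to \<open>y\<close> and completed by the local estimate near \<open>p\<close>. This is used twice:
  first from \<open>z\<close>, to see that arrival times are bounded by some \<open>M\<close> near \<open>z\<close>, and then between
  neighbours \<open>x\<close> and \<open>y\<close>, where the bound turns \<open>exp (L * \<tau>)\<close> into a constant.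
\<close>

lemma min_time_locally_holder:
  assumes L: "0 < L" and lip: "\<And>x y a. a \<in> A \<Longrightarrow> norm (F x a - F y a) \<le> L * norm (x - y)"
    and C: "0 \<le> C" and r: "0 < r" and \<alpha>: "0 < \<alpha>"
    and att: "\<And>x. x \<in> cball p r \<Longrightarrow> \<exists>\<tau>. reaches F A \<tau> x p \<and> \<tau> \<le> C * norm (x - p) powr \<alpha>"
  shows "locally_holder_on \<alpha> {x. min_time F A {p} x < \<infinity>} (\<lambda>x. enn2real (min_time F A {p} x))"
proof -
  let ?T = "min_time F A {p}"
  have transfer: "?T y \<le> ennreal (\<tau> + C * (exp (L * \<tau>) * norm (x - y)) powr \<alpha>)"
    if reach: "reaches F A \<tau> x p" and near: "exp (L * \<tau>) * norm (x - y) \<le> r" for x y \<tau>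
  proof -
    obtain a u where a: "a \<in> controls A" "is_trajectory F a x u" "u \<tau> = p" and \<tau>: "0 \<le> \<tau>"
      using reach by (auto simp: reaches_def)
    obtain w where w: "is_trajectory F a y w" using trajectory_exists[OF a(1)] by blast
    have "norm (u \<tau> - w \<tau>) \<le> exp (L * \<tau>) * norm (x - y)"
      by (rule trajectory_dependence(1)[OF a(2) w, of \<tau> UNIV])
        (use a(1) lip \<tau> L in \<open>auto simp: controls_iff\<close>)
    then have wp': "norm (w \<tau> - p) \<le> exp (L * \<tau>) * norm (x - y)"
      using a(3) by (simp add: norm_minus_commute)
    then have "w \<tau> \<in> cball p r" using near by (simp add: dist_norm norm_minus_commute)
    from att[OF this] obtain \<sigma> where \<sigma>: "reaches F A \<sigma> (w \<tau>) p" "\<sigma> \<le> C * norm (w \<tau> - p) powr \<alpha>"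
      by blast
    have "reaches F A \<tau> y (w \<tau>)" using a(1) w \<tau> by (auto simp: reaches_def)
    from min_time_le[OF reaches_trans[OF this \<sigma>(1)]]
    have "?T y \<le> ennreal (\<tau> + \<sigma>)" .
    also have "\<dots> \<le> ennreal (\<tau> + C * (exp (L * \<tau>) * norm (x - y)) powr \<alpha>)"
    proof (rule ennreal_leI)
      have "C * norm (w \<tau> - p) powr \<alpha> \<le> C * (exp (L * \<tau>) * norm (x - y)) powr \<alpha>"
        using C wp' \<alpha> by (intro mult_left_mono powr_mono2) auto
      with \<sigma>(2) show "\<tau> + \<sigma> \<le> \<tau> + C * (exp (L * \<tau>) * norm (x - y)) powr \<alpha>" by linarith
    qed
    finally show ?thesis .
  qed
  show ?thesis unfolding locally_holder_on_def
  proof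
    fix z assume "z \<in> {x. ?T x < \<infinity>}"
    then obtain t0 where "?T z = ennreal t0" "0 \<le> t0" by (cases "?T z") auto
    then have "?T z < ennreal (t0 + 1)" by (simp add: ennreal_less_iff)
    then obtain \<tau>0 where \<tau>0: "reaches F A \<tau>0 z p" by (rule reaches_before)
    then have \<tau>0_nonneg: "0 \<le> \<tau>0" by (simp add: reaches_def)
    define M where "M = \<tau>0 + C * r powr \<alpha> + 1"
    have M: "\<tau>0 \<le> M" "0 \<le> M" using \<tau>0_nonneg C by (auto simp: M_def)
    define E where "E = exp (L * M)"
    have E: "E > 0" by (simp add: E_def)
    have expE: "exp (L * \<tau>) \<le> E" if "\<tau> \<le> M" for \<tau> using that L by (simp add: E_def)
    define d where "d = r / (2 * E)"
    have d: "d > 0" using r E by (simp add: d_def)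
    have bound: "?T x < ennreal M" if x: "x \<in> ball z d" for x
    proof -
      have "exp (L * \<tau>0) * norm (z - x) \<le> E * d"
        using x expE[OF M(1)] E by (intro mult_mono) (auto simp: dist_norm)
      also have "E * d \<le> r" using E r by (simp add: d_def)
      finally have near: "exp (L * \<tau>0) * norm (z - x) \<le> r" .
      from transfer[OF \<tau>0 near] have "?T x \<le> ennreal (\<tau>0 + C * (exp (L * \<tau>0) * norm (z - x)) powr \<alpha>)" .
      also have "\<dots> < ennreal M"
      proof (rule ennreal_lessI)
        have "C * (exp (L * \<tau>0) * norm (z - x)) powr \<alpha> \<le> C * r powr \<alpha>"
          using C near \<alpha> by (intro mult_left_mono powr_mono2) auto
        then show "\<tau>0 + C * (exp (L * \<tau>0) * norm (z - x)) powr \<alpha> < M" by (simp add: M_def)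
        show "0 < M" using \<tau>0_nonneg C by (simp add: M_def add_nonneg_pos)
      qed
      finally show ?thesis .
    qed
    have one_sided: "enn2real (?T y) \<le> enn2real (?T x) + (C * E powr \<alpha>) * dist x y powr \<alpha>"
      if x: "x \<in> ball z d" and y: "y \<in> ball z d" for x y
    proof (rule field_le_epsilon)
      fix \<epsilon> :: real assume \<epsilon>: "0 < \<epsilon>"
      have fin: "?T x = ennreal (enn2real (?T x))"
        using bound[OF x] by (intro ennreal_enn2real[symmetric]) (auto intro: less_trans)
      have lt: "enn2real (?T x) < M"
        using bound[OF x] by (subst (asm) fin) (simp add: ennreal_less_iff)
      then have "enn2real (?T x) < min M (enn2real (?T x) + \<epsilon>)" using \<epsilon> by simp
      then have "?T x < ennreal (min M (enn2real (?T x) + \<epsilon>))"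
        by (subst fin) (simp add: ennreal_less_iff del: min_less_iff_conj)
      then obtain \<tau> where \<tau>: "\<tau> < min M (enn2real (?T x) + \<epsilon>)" "reaches F A \<tau> x p"
        by (rule reaches_before)
      have \<tau>_nonneg: "0 \<le> \<tau>" using \<tau>(2) by (simp add: reaches_def)
      have "norm (x - y) \<le> 2 * d"
        using x y dist_triangle2[of x y z] by (simp add: dist_norm[symmetric] dist_commute)
      then have "E * norm (x - y) \<le> E * (2 * d)" using E by (intro mult_left_mono) auto
      also have "\<dots> = r" using E by (simp add: d_def)
      finally have Er: "E * norm (x - y) \<le> r" .
      have \<tau>E: "exp (L * \<tau>) * norm (x - y) \<le> E * norm (x - y)"
        using expE[of \<tau>] \<tau>(1) by (intro mult_right_mono) auto
      have "?T y \<le> ennreal (\<tau> + C * (exp (L * \<tau>) * norm (x - y)) powr \<alpha>)"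
        using \<tau>E Er by (intro transfer[OF \<tau>(2)]) linarith
      then have "enn2real (?T y) \<le> \<tau> + C * (exp (L * \<tau>) * norm (x - y)) powr \<alpha>"
        using \<tau>_nonneg C by (intro enn2real_leI) auto
      also have "\<dots> \<le> \<tau> + C * (E * norm (x - y)) powr \<alpha>"
        using C \<tau>E \<alpha> by (intro add_left_mono mult_left_mono powr_mono2) auto
      also have "\<dots> = \<tau> + (C * E powr \<alpha>) * dist x y powr \<alpha>"
        using E by (simp add: powr_mult dist_norm mult.assoc)
      finally show "enn2real (?T y) \<le> enn2real (?T x) + (C * E powr \<alpha>) * dist x y powr \<alpha> + \<epsilon>"
        using \<tau>(1) by simp
    qed
    show "\<exists>\<delta>>0. \<exists>C. \<forall>x\<in>{x. ?T x < \<infinity>} \<inter> ball z \<delta>. \<forall>y\<in>{x. ?T x < \<infinity>} \<inter> ball z \<delta>.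
        dist (enn2real (?T x)) (enn2real (?T y)) \<le> C * dist x y powr \<alpha>"
    proof (rule exI[of _ d], rule conjI[OF d], rule exI[of _ "C * E powr \<alpha>"], intro ballI)
      fix x y assume "x \<in> {x. ?T x < \<infinity>} \<inter> ball z d" "y \<in> {x. ?T x < \<infinity>} \<inter> ball z d"
      then have "x \<in> ball z d" "y \<in> ball z d" by auto
      from one_sided[OF this] one_sided[OF this(2,1)]
      show "dist (enn2real (?T x)) (enn2real (?T y)) \<le> (C * E powr \<alpha>) * dist x y powr \<alpha>"
        unfolding dist_commute[of y x] dist_real_def by linarith
    qed
  qed
qed

end

section \<open>Attainability of a point by high order variations\<close>

theorem theorem4p4:
  fixes F :: "real ^ 'n \<Rightarrow> 'b::metric_space \<Rightarrow> real ^ 'n"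
    and A :: "'b set"
    and x\<^sub>o :: "real ^ 'n"
    and R L\<^sub>0 :: real
    and m :: nat
    and f :: "nat \<Rightarrow> 'n vfield list"  \<comment> \<open>\<open>f i\<close> is the \<open>i\<close>-th group, so \<open>j(i) = length (f i)\<close>\<close>
    and k :: "nat \<Rightarrow> nat"
    and A\<^sub>o :: "nat \<Rightarrow> real ^ 'n"     \<comment> \<open>the columns of the matrix\<close>
    and kbar :: nat
  assumes A_compact: "compact A"
    and F_cont: "continuous_on (UNIV \<times> A) (\<lambda>(x, a). F x a)"
    and R_pos: "R > 0" and L0_pos: "L\<^sub>0 > 0"
    and F_lipschitz: "\<And>x y a. \<lbrakk>x \<in> cball x\<^sub>o R; y \<in> cball x\<^sub>o R; a \<in> A\<rbrakk>
                        \<Longrightarrow> norm (F x a - F y a) \<le> L\<^sub>0 * norm (x - y)"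
    and wp: "well_posed F A"
    and f_available: "\<And>i g. \<lbrakk>i \<in> {1..m}; g \<in> set (f i)\<rbrakk> \<Longrightarrow> available F A g"
    and k_pos: "\<And>i. i \<in> {1..m} \<Longrightarrow> k i > 0"
    and f_smooth: "\<And>i g. \<lbrakk>i \<in> {1..m}; g \<in> set (f i)\<rbrakk> \<Longrightarrow> Ck (k i - 1) g"
    and single: "\<And>i. \<lbrakk>i \<in> {1..m}; k i = 1\<rbrakk> \<Longrightarrow> length (f i) = 1"
    and vanish: "\<And>i r. \<lbrakk>i \<in> {1..m}; 1 \<le> r; r < k i\<rbrakk> \<Longrightarrow> H_boxplus_vec (f i) r id x\<^sub>o = 0"
    and Ao_def: "\<And>i. i \<in> {1..m}
                   \<Longrightarrow> A\<^sub>o i = (1 / fact (k i)) *\<^sub>R H_boxplus_vec (f i) (k i) id x\<^sub>o"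
    and Ao_nonzero: "\<And>i. i \<in> {1..m} \<Longrightarrow> A\<^sub>o i \<noteq> 0"
    and kbar_def: "kbar = Max (k ` {1..m})"
    and Ao_positive: "positive_basis m A\<^sub>o"
  shows "STLA F A {x\<^sub>o} x\<^sub>o \<and>
     (\<exists>C::real. \<forall>\<^sub>F x in nhds x\<^sub>o.
        min_time F A {x\<^sub>o} x \<le> ennreal (C * norm (x - x\<^sub>o) powr (1 / real kbar))) \<and>
     ((\<exists>L>0. \<forall>x y. \<forall>a\<in>A. norm (F x a - F y a) \<le> L * norm (x - y)) \<longrightarrow>
        locally_holder_on (1 / real kbar) {x. min_time F A {x\<^sub>o} x < \<infinity>}
          (\<lambda>x. enn2real (min_time F A {x\<^sub>o} x)))"
proof -
  interpret locally_lipschitz_system F A x\<^sub>o R L\<^sub>0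
    by unfold_locales (use assms in auto)
  obtain C r where C: "0 \<le> C" and r: "0 < r" and att:
    "\<And>x. x \<in> cball x\<^sub>o r \<Longrightarrow> \<exists>\<tau>. reaches F A \<tau> x x\<^sub>o \<and> \<tau> \<le> C * norm (x - x\<^sub>o) powr (1 / real kbar)"
    and kbar: "0 < kbar" and nonempty: "A \<noteq> {}"
  proof -
    have m: "1 \<le> m"
    proof (rule ccontr)
      \<comment> \<open>An empty family would span only the zero vector.\<close>
      assume "\<not> 1 \<le> m"
      then have "axis undefined 1 = (0 :: real ^ 'n)" using Ao_positive by (auto simp: positive_basis_def)
      then show False by (simp add: axis_eq_0_iff)
    qed
    have k_le: "0 < k i \<and> k i \<le> kbar" if "i \<in> {1..m}" for i
      using k_pos[OF that] that unfolding kbar_def by auto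
    then have kbar: "0 < kbar" using m by force
    have "f 1 \<noteq> []"
    proof
      assume "f 1 = []"
      then have "H_boxplus_vec (f 1) (k 1) id x\<^sub>o = 0"
        using k_pos[of 1] m by (simp add: H_boxplus_vec_def H_boxplus_Nil vec_eq_iff)
      then show False using Ao_nonzero[of 1] Ao_def[of 1] m by simp
    qed
    then have nonempty: "A \<noteq> {}"
      using f_available[of 1 "hd (f 1)"] m by (auto simp: available_def)
    have "\<exists>C\<ge>0. \<exists>r>0. \<forall>x\<in>cball x\<^sub>o r. \<exists>\<tau> z. reaches F A \<tau> x z \<and>
      norm (z - x\<^sub>o) \<le> norm (x - x\<^sub>o) / 2 \<and> \<tau> \<le> C * root kbar (norm (x - x\<^sub>o))"
    proof (rule contraction_step[OF nonempty _ _ _ k_le kbar Ao_positive])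
      show "reaches F A (real (length (f i)) * t) x (group_flow (f i) x t)"
        if "i \<in> {1..m}" "0 \<le> t" for i x t
        using f_available that by (intro group_flow_reaches[OF nonempty]) auto
      show "\<exists>K>0. \<forall>e>0. \<exists>d>0. \<forall>t x. 0 \<le> t \<longrightarrow> t \<le> d \<longrightarrow> norm (x - x\<^sub>o) \<le> d \<longrightarrow>
        norm (group_flow (f i) x t - x - t ^ k i *\<^sub>R A\<^sub>o i) \<le> e * t ^ k i + K * t * norm (x - x\<^sub>o)"
        if "i \<in> {1..m}" for i
        using that f_available f_smooth k_pos vanish Ao_def by (intro group_flow_step) auto
    qed auto
    then obtain C r where C: "0 \<le> C" and r: "0 < r" and step:
      "\<forall>x\<in>cball x\<^sub>o r. \<exists>\<tau> z. reaches F A \<tau> x z \<and>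
        norm (z - x\<^sub>o) \<le> norm (x - x\<^sub>o) / 2 \<and> \<tau> \<le> C * root kbar (norm (x - x\<^sub>o))"
      by blast
    show ?thesis
    proof (rule that[OF _ r _ kbar nonempty])
      show "0 \<le> C / (1 - root kbar (1 / 2))" using C kbar by simp
      show "\<exists>\<tau>. reaches F A \<tau> x x\<^sub>o \<and>
          \<tau> \<le> C / (1 - root kbar (1 / 2)) * norm (x - x\<^sub>o) powr (1 / real kbar)"
        if "x \<in> cball x\<^sub>o r" for x
        using attainable_from_contraction[OF kbar C r step that] kbar
        by (simp add: root_eq_powr[symmetric])
    qed
  qed
  let ?T = "min_time F A {x\<^sub>o}"
  have bound: "?T x \<le> ennreal (C * norm (x - x\<^sub>o) powr (1 / real kbar))" if x: "x \<in> cball x\<^sub>o r" for x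
  proof -
    obtain \<tau> where \<tau>: "reaches F A \<tau> x x\<^sub>o" "\<tau> \<le> C * norm (x - x\<^sub>o) powr (1 / real kbar)"
      using att[OF x] by blast
    from min_time_le[OF \<tau>(1)] ennreal_leI[OF \<tau>(2)] show ?thesis by (rule order_trans)
  qed
  have near: "eventually (\<lambda>x. ?T x \<le> ennreal (C * norm (x - x\<^sub>o) powr (1 / real kbar))) (nhds x\<^sub>o)"
    using r bound by (auto simp: eventually_nhds_metric dist_commute intro!: exI[of _ r])
  have "?T x\<^sub>o = 0"
    using min_time_le[OF reaches_refl[OF nonempty, of x\<^sub>o]] by simp
  moreover have "(?T \<longlongrightarrow> 0) (at x\<^sub>o)"
  proof (rule tendsto_sandwich[where f="\<lambda>_. 0"
        and h="\<lambda>x. ennreal (C * norm (x - x\<^sub>o) powr (1 / real kbar))"])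
    show "eventually (\<lambda>x. ?T x \<le> ennreal (C * norm (x - x\<^sub>o) powr (1 / real kbar))) (at x\<^sub>o)"
      using near unfolding eventually_at_filter by (rule eventually_mono) simp
    have "((\<lambda>x. C * norm (x - x\<^sub>o) powr (1 / real kbar)) \<longlongrightarrow> C * 0) (at x\<^sub>o)"
      using kbar
      by (intro tendsto_mult tendsto_const tendsto_zero_powrI[where b="1 / real kbar"] tendsto_norm_zero LIM_zero tendsto_ident_at) auto
    from tendsto_ennrealI[OF this]
    show "((\<lambda>x. ennreal (C * norm (x - x\<^sub>o) powr (1 / real kbar))) \<longlongrightarrow> 0) (at x\<^sub>o)"
      by simp
  qed auto
  ultimately have stla: "STLA F A {x\<^sub>o} x\<^sub>o" by (simp add: STLA_def isCont_def)
  have "locally_holder_on (1 / real kbar) {x. ?T x < \<infinity>} (\<lambda>x. enn2real (?T x))"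
    if "\<exists>L>0. \<forall>x y. \<forall>a\<in>A. norm (F x a - F y a) \<le> L * norm (x - y)"
  proof -
    from that obtain L where L: "L > 0" "\<forall>x y. \<forall>a\<in>A. norm (F x a - F y a) \<le> L * norm (x - y)"
      by blast
    show ?thesis
      by (rule min_time_locally_holder[OF L(1) _ C r _ att]) (use L(2) kbar in auto)
  qed
  with stla near show ?thesis by blast
qed

end
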